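(* Let $\mathcal B$ and $\mathcal C$ be $\mathfrak q_n^+$-crystals. Then the $\mathfrak{gl}_n$-crystal $\mathcal B\otimes\mathcal C$ has a unique $\mathfrak q_n^+$-crystal structure in which $e_0$ and $f_0$ are given by $$e_0(b\otimes c)=\begin{cases}e_0(b)\otimes c&\text{if }\mathrm{wt}(b)_1\ne0\\ b\otimes e_0(c)&\text{if }\mathrm{wt}(b)_1=0\end{cases}\quad\text{and}\quad f_0(b\otimes c)=\begin{cases}f_0(b)\otimes c&\text{if }\mathrm{wt}(b)_1\ne0\\ b\otimes f_0(c)&\text{if }\mathrm{wt}(b)_1=0\end{cases}$$ and in which (when $n\ge2$) $e_{\bar1}$ and $f_{\bar1}$ are given by $$e_{\bar1}(b\otimes c)=\begin{cases}b\otimes e_{\bar1}(c)&\text{if }\mathrm{wt}(b)_1=\mathrm{wt}(b)_2=0\\ f_0e_{\bar1}(b)\otimes e_0(c)&\text{if }\mathrm{wt}(b)_1=0,\ f_0e_{\bar1}(b)\ne0,\text{ and }e_0(c)\ne0\\ e_0e_{\bar1}(b)\otimes f_0(c)&\text{if }\mathrm{wt}(b)_1=0,\ e_0e_{\bar1}(b)\ne0,\text{ and }f_0(c)\ne0\\ e_{\bar1}(b)\otimes c&\text{otherwise}\end{cases}$$ $$f_{\bar1}(b\otimes c)=\begin{cases}b\otimes f_{\bar1}(c)&\text{if }\mathrm{wt}(b)_1=\mathrm{wt}(b)_2=0\\ f_{\bar1}f_0(b)\otimes e_0(c)&\text{if }\mathrm{wt}(b)_1=1,\ f_{\bar1}f_0(b)\ne0,\text{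 and }e_0(c)\ne0\\ f_{\bar1}e_0(b)\otimes f_0(c)&\text{if }\mathrm{wt}(b)_1=1,\ f_{\bar1}e_0(b)\ne0,\text{ and }f_0(c)\ne0\\ f_{\bar1}(b)\otimes c&\text{otherwise}\end{cases}$$ where it is understood that $b\otimes0=0\otimes c=0$. Moreover, if $\mathcal D$ is another $\mathfrak q_n^+$-crystal, then the bijection $(b\otimes c)\otimes d\mapsto b\otimes(c\otimes d)$ is a $\mathfrak q_n^+$-crystal isomorphism $(\mathcal B\otimes\mathcal C)\otimes\mathcal D\cong\mathcal B\otimes(\mathcal C\otimes\mathcal D)$.
   Context: Here $n$ is a positive integer, $\mathbb N=\{0,1,2,\dots\}$, $[k]=\{1,\dots,k\}$, $[p,q]=\{i\in\mathbb Z:p\le i\le q\}$; $\mathbf e_1,\dots,\mathbf e_n$ is the standard basis of $\mathbb Z^n$. All crystals are nonempty sets $\mathcal B$ with a weight map $\mathrm{wt}:\mathcal B\to\mathbb Z^n$ and raising/lowering operators $e_i,f_i:\mathcal B\to\mathcal B\sqcup\{0\}$, where $0\notin\mathcal B$ is an auxiliary element (operators send $0$ to $0$). Put $\varepsilon_i(b)=\max\{k\in\mathbb N:e_i^k(b)\ne0\}$ and $\varphi_i(b)=\max\{k\in\mathbb N:f_i^k(b)\ne0\}$ in $\mathbb N\sqcup\{\infty\}$. A *$\mathfrak{gl}_n$-crystal* has operators indexed by $i\in[n-1]$ such that for all $b,c\in\mathcal B$ and $i\in[n-1]$: (S1) $e_i(b)=c$ iff $f_i(c)=b$, in which case $\mathrm{wt}(c)-\mathrm{wt}(b)=\mathbf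 e_i-\mathbf e_{i+1}$; (S2) $\varepsilon_i(b),\varphi_i(b)$ are finite and $\varphi_i(b)-\varepsilon_i(b)=\mathrm{wt}(b)_i-\mathrm{wt}(b)_{i+1}$. For $n\ge2$, a *$\mathfrak q_n$-crystal* is a $\mathfrak{gl}_n$-crystal with $\mathrm{wt}(\mathcal B)\subset\mathbb N^n$ and additional operators $e_{\bar1},f_{\bar1}$ such that for all $b,c\in\mathcal B$: (P1) $e_{\bar1}(b)=c$ iff $f_{\bar1}(c)=b$, in which case $\mathrm{wt}(c)-\mathrm{wt}(b)=\mathbf e_1-\mathbf e_2$ and $\varepsilon_i(b)=\varepsilon_i(c)$, $\varphi_i(b)=\varphi_i(c)$ for $i\in[3,n-1]$; (P2) for $i\in[3,n-1]$, $e_i,f_i$ commute with $e_{\bar1},f_{\bar1}$; (P3) $(\varepsilon_{\bar1}+\varphi_{\bar1})(b)=0$ if $\mathrm{wt}(b)_1=\mathrm{wt}(b)_2=0$, and $=1$ otherwise. A *$\mathfrak q_1$-crystal* is a nonempty set with a map $\mathrm{wt}:\mathcal B\to\mathbb N$. A *$\mathfrak q_n^+$-crystal* is a $\mathfrak q_n$-crystal with additional operators $e_0,f_0$ such that for all $b,c\in\mathcal B$: (Q1) $e_0(b)=c$ iff $f_0(c)=b$, in which case $\mathrm{wt}(b)=\mathrm{wt}(c)$ and $\varepsilon_i(b)=\varepsilon_i(c)$, $\varphi_i(b)=\varphi_i(c)$ for all $i\in[n-1]$ and also for $i=\bar1$ if $n\ge2$; (Q2) for $i\in[2,n-1]$,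 $e_i,f_i$ commute with $e_0,f_0$; (Q3) $(\varepsilon_0+\varphi_0)(b)=0$ if $\mathrm{wt}(b)_1=0$, and $=1$ otherwise. The crystal graph has vertex set $\mathcal B$ and an edge $b\xrightarrow{i}c$ whenever $f_i(b)=c\neq0$. An *isomorphism* is a weight-preserving bijection giving an isomorphism of labeled crystal graphs. The $\mathfrak{gl}_n$-crystal $\mathcal B\otimes\mathcal C$ is the set $\{b\otimes c:b\in\mathcal B,c\in\mathcal C\}$ of formal tensors with $\mathrm{wt}(b\otimes c)=\mathrm{wt}(b)+\mathrm{wt}(c)$ and, for $i\in[n-1]$, $e_i(b\otimes c)=b\otimes e_i(c)$ if $\varepsilon_i(b)\le\varphi_i(c)$ and $e_i(b)\otimes c$ if $\varepsilon_i(b)>\varphi_i(c)$; $f_i(b\otimes c)=b\otimes f_i(c)$ if $\varepsilon_i(b)<\varphi_i(c)$ and $f_i(b)\otimes c$ if $\varepsilon_i(b)\ge\varphi_i(c)$. *)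

theory Defs
  imports "HOL-Library.Extended_Nat"
begin

text \<open>
  The auxiliary element \<open>0\<close> is \<open>None\<close>, so an operator \<open>B \<rightarrow> B \<squnion> {0}\<close> is a function into
  an option type, and operators are composed with \<open>Option.bind\<close>.  The crystal itself is an
  explicit carrier set.  To have each crystal represented by exactly one tuple of operators
  (so that a uniqueness claim is an equality of records), operators are required to be \<open>None\<close>
  outside the carrier and at indices where the crystal has no operator; this is a
  normalisation, not a restriction.

  Vectors of \<open>\<int>\<^sup>n\<close> are functions \<open>nat \<Rightarrow> int\<close> that vanish outside \<open>{1..n}\<close>.
\<close>

record 'b gl_data =
  carrier :: "'b set"
  wt :: "'b \<Rightarrow> nat \<Rightarrow> int"
  e_op :: "nat \<Rightarrow> 'b \<Rightarrow> 'b option"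
  f_op :: "nat \<Rightarrow> 'b \<Rightarrow> 'b option"

record 'b q_data = "'b gl_data" +
  e_bar :: "'b \<Rightarrow> 'b option"
  f_bar :: "'b \<Rightarrow> 'b option"

record 'b qplus_data = "'b q_data" +
  e_zero :: "'b \<Rightarrow> 'b option"
  f_zero :: "'b \<Rightarrow> 'b option"

definition op_pow :: "('b \<Rightarrow> 'b option) \<Rightarrow> nat \<Rightarrow> 'b \<Rightarrow> 'b option" where
  "op_pow g k b = ((\<lambda>x. Option.bind x g) ^^ k) (Some b)"

text \<open>
  With \<open>g = e\<^sub>i\<close> this is \<open>\<epsilon>\<^sub>i\<close>, with \<open>g = f\<^sub>i\<close> it is \<open>\<phi>\<^sub>i\<close>.  The set contains \<open>0\<close>; its supremum
  in \<^typ>\<open>enat\<close> is its maximum if it is finite and \<open>\<infinity>\<close> otherwise.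
\<close>
definition string_len :: "('b \<Rightarrow> 'b option) \<Rightarrow> 'b \<Rightarrow> enat" where
  "string_len g b = Sup (enat ` {k. op_pow g k b \<noteq> None})"

definition operator_on :: "'b set \<Rightarrow> ('b \<Rightarrow> 'b option) \<Rightarrow> bool" where
  "operator_on A g \<longleftrightarrow>
     (\<forall>b\<in>A. \<forall>c. g b = Some c \<longrightarrow> c \<in> A) \<and> (\<forall>b. b \<notin> A \<longrightarrow> g b = None)"

definition ops_commute :: "'b set \<Rightarrow> ('b \<Rightarrow> 'b option) \<Rightarrow> ('b \<Rightarrow> 'b option) \<Rightarrow> bool" where
  "ops_commute A g h \<longleftrightarrow> (\<forall>b\<in>A. Option.bind (g b) h = Option.bind (h b) g)"

definition std_basis :: "nat \<Rightarrow> nat \<Rightarrow> int" where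
  "std_basis i j = (if j = i then 1 else 0)"

definition gl_crystal :: "nat \<Rightarrow> ('b, 'z) gl_data_scheme \<Rightarrow> bool" where
  "gl_crystal n B \<longleftrightarrow>
     carrier B \<noteq> {} \<and>
     (\<forall>b\<in>carrier B. \<forall>j. j \<notin> {1..n} \<longrightarrow> wt B b j = 0) \<and>
     (\<forall>i\<in>{1..<n}. operator_on (carrier B) (e_op B i) \<and> operator_on (carrier B) (f_op B i)) \<and>
     (\<forall>i. i \<notin> {1..<n} \<longrightarrow> (\<forall>b. e_op B i b = None \<and> f_op B i b = None)) \<and>
     (\<forall>b\<in>carrier B. \<forall>c\<in>carrier B. \<forall>i\<in>{1..<n}.
        (e_op B i b = Some c \<longleftrightarrow> f_op B i c = Some b) \<and>
        (e_op B i b = Some c \<longrightarrow>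
           (\<forall>j. wt B c j - wt B b j = std_basis i j - std_basis (i + 1) j))) \<and>
     (\<forall>b\<in>carrier B. \<forall>i\<in>{1..<n}.
        string_len (e_op B i) b \<noteq> \<infinity> \<and> string_len (f_op B i) b \<noteq> \<infinity> \<and>
        int (the_enat (string_len (f_op B i) b)) - int (the_enat (string_len (e_op B i) b))
          = wt B b i - wt B b (i + 1))"

text \<open>For \<open>n = 1\<close> this is just a nonempty set with a map to \<open>\<nat>\<close>.\<close>
definition q_crystal :: "nat \<Rightarrow> ('b, 'z) q_data_scheme \<Rightarrow> bool" where
  "q_crystal n B \<longleftrightarrow>
     gl_crystal n B \<and>
     (\<forall>b\<in>carrier B. \<forall>j. 0 \<le> wt B b j) \<and>
     (n < 2 \<longrightarrow> (\<forall>b. e_bar B b = None \<and> f_bar B b = None)) \<and>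
     (2 \<le> n \<longrightarrow>
       operator_on (carrier B) (e_bar B) \<and> operator_on (carrier B) (f_bar B) \<and>
       (\<forall>b\<in>carrier B. \<forall>c\<in>carrier B.
          (e_bar B b = Some c \<longleftrightarrow> f_bar B c = Some b) \<and>
          (e_bar B b = Some c \<longrightarrow>
             (\<forall>j. wt B c j - wt B b j = std_basis 1 j - std_basis 2 j) \<and>
             (\<forall>i\<in>{3..<n}. string_len (e_op B i) b = string_len (e_op B i) c \<and>
                          string_len (f_op B i) b = string_len (f_op B i) c))) \<and>
       (\<forall>i\<in>{3..<n}.
          ops_commute (carrier B) (e_op B i) (e_bar B) \<and>
          ops_commute (carrier B) (e_op B i) (f_bar B) \<and>
          ops_commute (carrier B) (f_op B i) (e_bar B) \<and>
          ops_commute (carrier B) (f_op B i) (f_bar B)) \<and>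
       (\<forall>b\<in>carrier B. string_len (e_bar B) b + string_len (f_bar B) b =
          (if wt B b 1 = 0 \<and> wt B b 2 = 0 then 0 else 1)))"

definition qplus_crystal :: "nat \<Rightarrow> ('b, 'z) qplus_data_scheme \<Rightarrow> bool" where
  "qplus_crystal n B \<longleftrightarrow>
     q_crystal n B \<and>
     operator_on (carrier B) (e_zero B) \<and> operator_on (carrier B) (f_zero B) \<and>
     (\<forall>b\<in>carrier B. \<forall>c\<in>carrier B.
        (e_zero B b = Some c \<longleftrightarrow> f_zero B c = Some b) \<and>
        (e_zero B b = Some c \<longrightarrow>
           wt B b = wt B c \<and>
           (\<forall>i\<in>{1..<n}. string_len (e_op B i) b = string_len (e_op B i) c \<and>
                        string_len (f_op B i) b = string_len (f_op B i) c) \<and>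
           (2 \<le> n \<longrightarrow> string_len (e_bar B) b = string_len (e_bar B) c \<and>
                     string_len (f_bar B) b = string_len (f_bar B) c))) \<and>
     (\<forall>i\<in>{2..<n}.
        ops_commute (carrier B) (e_op B i) (e_zero B) \<and>
        ops_commute (carrier B) (e_op B i) (f_zero B) \<and>
        ops_commute (carrier B) (f_op B i) (e_zero B) \<and>
        ops_commute (carrier B) (f_op B i) (f_zero B)) \<and>
     (\<forall>b\<in>carrier B. string_len (e_zero B) b + string_len (f_zero B) b =
        (if wt B b 1 = 0 then 0 else 1))"

datatype label = Label_zero | Label_bar | Label nat

definition labels :: "nat \<Rightarrow> label set" where
  "labels n = {Label_zero} \<union> (if 2 \<le> n then {Label_bar} else {}) \<union> Label ` {1..<n}"

fun lower :: "('b, 'z) qplus_data_scheme \<Rightarrow> label \<Rightarrow> 'b \<Rightarrow> 'b option" where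
  "lower B Label_zero = f_zero B"
| "lower B Label_bar = f_bar B"
| "lower B (Label i) = f_op B i"

definition crystal_edge :: "('b, 'z) qplus_data_scheme \<Rightarrow> label \<Rightarrow> 'b \<Rightarrow> 'b \<Rightarrow> bool" where
  "crystal_edge B l b c \<longleftrightarrow> b \<in> carrier B \<and> c \<in> carrier B \<and> lower B l b = Some c"

definition qplus_iso ::
  "nat \<Rightarrow> ('b, 'y) qplus_data_scheme \<Rightarrow> ('c, 'z) qplus_data_scheme \<Rightarrow> ('b \<Rightarrow> 'c) \<Rightarrow> bool" where
  "qplus_iso n B C h \<longleftrightarrow>
     bij_betw h (carrier B) (carrier C) \<and>
     (\<forall>b\<in>carrier B. wt C (h b) = wt B b) \<and>
     (\<forall>l\<in>labels n. \<forall>b\<in>carrier B. \<forall>b'\<in>carrier B.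
        crystal_edge B l b b' \<longleftrightarrow> crystal_edge C l (h b) (h b'))"

text \<open>The formal tensor \<open>b \<otimes> c\<close> is the pair \<open>(b, c)\<close>, with \<open>b \<otimes> 0 = 0 \<otimes> c = 0\<close>.\<close>
definition otensor :: "'b option \<Rightarrow> 'c option \<Rightarrow> ('b \<times> 'c) option" (infixr "\<otimes>" 70) where
  "x \<otimes> y = Option.bind x (\<lambda>b. map_option (Pair b) y)"

definition gl_tensor ::
  "nat \<Rightarrow> ('b, 'y) gl_data_scheme \<Rightarrow> ('c, 'z) gl_data_scheme \<Rightarrow> ('b \<times> 'c) gl_data" where
  "gl_tensor n B C = \<lparr>
     carrier = carrier B \<times> carrier C,
     wt = (\<lambda>(b, c) j. wt B b j + wt C c j),
     e_op = (\<lambda>i (b, c).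
       if i \<in> {1..<n} \<and> b \<in> carrier B \<and> c \<in> carrier C
       then if string_len (e_op B i) b \<le> string_len (f_op C i) c
            then Some b \<otimes> e_op C i c else e_op B i b \<otimes> Some c
       else None),
     f_op = (\<lambda>i (b, c).
       if i \<in> {1..<n} \<and> b \<in> carrier B \<and> c \<in> carrier C
       then if string_len (e_op B i) b < string_len (f_op C i) c
            then Some b \<otimes> f_op C i c else f_op B i b \<otimes> Some c
       else None) \<rparr>"

text \<open>
  \<open>X\<close> is a \<open>\<qq>\<^sub>n\<^sup>+\<close>-crystal structure on the \<open>\<gg>\<ll>\<^sub>n\<close>-crystal \<open>B \<otimes> C\<close> whose remaining operators are
  given by the prescribed formulas.  A composite such as \<open>f\<^sub>0 e\<^sub>1 (b)\<close> (barred \<open>1\<close>) is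
  \<open>Option.bind (e_bar B b) (f_zero B)\<close>: the inner operator comes first.
\<close>
definition is_qplus_tensor ::
  "nat \<Rightarrow> 'b qplus_data \<Rightarrow> 'c qplus_data \<Rightarrow> ('b \<times> 'c) qplus_data \<Rightarrow> bool" where
  "is_qplus_tensor n B C X \<longleftrightarrow>
     qplus_crystal n X \<and>
     gl_data.truncate X = gl_tensor n B C \<and>
     (\<forall>b\<in>carrier B. \<forall>c\<in>carrier C.
        e_zero X (b, c) =
          (if wt B b 1 \<noteq> 0 then e_zero B b \<otimes> Some c else Some b \<otimes> e_zero C c) \<and>
        f_zero X (b, c) =
          (if wt B b 1 \<noteq> 0 then f_zero B b \<otimes> Some c else Some b \<otimes> f_zero C c)) \<and>
     (2 \<le> n \<longrightarrow> (\<forall>b\<in>carrier B. \<forall>c\<in>carrier C.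
        e_bar X (b, c) =
          (if wt B b 1 = 0 \<and> wt B b 2 = 0 then
             Some b \<otimes> e_bar C c
           else if wt B b 1 = 0 \<and> Option.bind (e_bar B b) (f_zero B) \<noteq> None
                     \<and> e_zero C c \<noteq> None then
             Option.bind (e_bar B b) (f_zero B) \<otimes> e_zero C c
           else if wt B b 1 = 0 \<and> Option.bind (e_bar B b) (e_zero B) \<noteq> None
                     \<and> f_zero C c \<noteq> None then
             Option.bind (e_bar B b) (e_zero B) \<otimes> f_zero C c
           else e_bar B b \<otimes> Some c) \<and>
        f_bar X (b, c) =
          (if wt B b 1 = 0 \<and> wt B b 2 = 0 then
             Some b \<otimes> f_bar C c
           else if wt B b 1 = 1 \<and> Option.bind (f_zero B b) (f_bar B) \<noteq> None
                     \<and> e_zero C c \<noteq> None then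
             Option.bind (f_zero B b) (f_bar B) \<otimes> e_zero C c
           else if wt B b 1 = 1 \<and> Option.bind (e_zero B b) (f_bar B) \<noteq> None
                     \<and> f_zero C c \<noteq> None then
             Option.bind (e_zero B b) (f_bar B) \<otimes> f_zero C c
           else f_bar B b \<otimes> Some c)))"

definition qplus_tensor ::
  "nat \<Rightarrow> 'b qplus_data \<Rightarrow> 'c qplus_data \<Rightarrow> ('b \<times> 'c) qplus_data" where
  "qplus_tensor n B C = (THE X. is_qplus_tensor n B C X)"

end

theory Submission
  imports Defs
begin

text \<open>
  The operators on \<open>B \<otimes> C\<close> are prescribed, so uniqueness is immediate; the content is that they
  satisfy the axioms and that the construction is associative.

  For the \<open>\<gg>\<ll>\<^sub>n\<close>-part everything rests on the string lengths of a tensor,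
  \<open>\<epsilon>\<^sub>i(b \<otimes> c) = \<epsilon>\<^sub>i(c) + max 0 (\<epsilon>\<^sub>i(b) - \<phi>\<^sub>i(c))\<close> and
  \<open>\<phi>\<^sub>i(b \<otimes> c) = \<phi>\<^sub>i(b) + max 0 (\<phi>\<^sub>i(c) - \<epsilon>\<^sub>i(b))\<close> (lemma \<open>gl_tensor_string_len\<close>).  They give the weight
  condition (S2) and reduce associativity of the \<open>i\<close>-edges to linear arithmetic.

  The remaining axioms are of three kinds.  Commutation and preservation of string lengths
  (P1, P2, Q1, Q2): call a map equivariant for \<open>i\<close> if it commutes with \<open>e\<^sub>i\<close> and preserves \<open>\<epsilon>\<^sub>i\<close>
  and \<open>\<phi>\<^sub>i\<close>.  Such maps are closed under composition, tensoring and case distinction by conditions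
  constant along \<open>i\<close>-strings, and the prescribed operators are built in just this way from operators
  on the factors (\<open>tensor_zero_equivariant\<close>, \<open>tensor_bar_equivariant\<close>).  Dichotomy (P3, Q3): for
  mutually inverse operators, the sum of the two string lengths being at most one only concerns which
  operator vanishes at which element (\<open>string_len_sum_iff\<close>), and on a tensor this is inherited from
  one of the factors (\<open>tensor_bar_eq_None\<close>).  Mutual inverseness of the barred operators is the
  delicate point.  A raising step from \<open>wt(b)\<^sub>1 = 0\<close> may apply \<open>f\<^sub>0\<close> on the left and \<open>e\<^sub>0\<close> on
  the right, or conversely; it ends at first weight \<open>1\<close>, and there the lowering formula applies the
  opposite pair (\<open>tensor_bar_inverse\<close>).

  Associativity of the barred edges holds because the raising operator acts on the leftmost factor
  whose first two weights are not both zero, and couples it, if its first weight is zero, to the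
  next factor with nonzero first weight.  This description ignores brackets (\<open>tensor_bar_assoc\<close>).
\<close>

section \<open>String lengths\<close>

lemma op_pow_0: "op_pow g 0 b = Some b"
  by (simp add: op_pow_def)

lemma op_pow_Suc: "op_pow g (Suc k) b = Option.bind (g b) (op_pow g k)"
proof -
  have none: "((\<lambda>x. Option.bind x g) ^^ k) None = None" for k
    by (induction k) auto
  show ?thesis
    by (cases "g b") (simp_all add: op_pow_def funpow_Suc_right none del: funpow.simps)
qed

lemma string_len_None: "g b = None \<Longrightarrow> string_len g b = 0"
proof -
  assume g: "g b = None"
  have "{k. op_pow g k b \<noteq> None} = {0}"
  proof -
    have "op_pow g k b \<noteq> None \<longleftrightarrow> k = 0" for k
      by (cases k) (simp_all add: op_pow_0 op_pow_Suc g)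
    then show ?thesis by auto
  qed
  then show ?thesis by (simp add: string_len_def zero_enat_def)
qed

text \<open>
  The lengths \<open>\<epsilon>\<^sub>i\<close> and \<open>\<phi>\<^sub>i\<close> are suprema over iterates; every later computation with them goes
  through this one-step recursion, together with \<open>string_len_None\<close>.
\<close>
lemma string_len_Some: "g b = Some c \<Longrightarrow> string_len g b = eSuc (string_len g c)"
proof -
  assume g: "g b = Some c"
  let ?K = "\<lambda>b. {k. op_pow g k b \<noteq> None}"
  have "k \<in> ?K b \<longleftrightarrow> k = 0 \<or> (\<exists>j\<in>?K c. k = Suc j)" for k
    by (cases k) (auto simp: op_pow_0 op_pow_Suc g)
  then have K: "?K b = insert 0 (Suc ` ?K c)" by auto
  have 0: "0 \<in> ?K c" by (simp add: op_pow_0)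
  have "enat ` ?K b = insert 0 (eSuc ` enat ` ?K c)"
    unfolding K by (simp add: image_image eSuc_enat zero_enat_def)
  then have "string_len g b = Sup (eSuc ` enat ` ?K c)"
    by (simp add: string_len_def sup_enat_def)
  also have "\<dots> = eSuc (string_len g c)"
    unfolding string_len_def using 0 by (subst eSuc_Sup) auto
  finally show ?thesis .
qed

section \<open>Tensor products of \<open>\<gg>\<ll>\<^sub>n\<close>-crystals\<close>

text \<open>
  In a \<open>\<gg>\<ll>\<^sub>n\<close>-crystal all string lengths are finite, so working with natural numbers turns the tensor
  product rule into linear arithmetic.  Truncated subtraction will play the role of
  \<open>max 0 (x - y)\<close>.
\<close>
definition eps :: "('b, 'z) gl_data_scheme \<Rightarrow> nat \<Rightarrow> 'b \<Rightarrow> nat" where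
  "eps B i b = the_enat (string_len (e_op B i) b)"

definition phi :: "('b, 'z) gl_data_scheme \<Rightarrow> nat \<Rightarrow> 'b \<Rightarrow> nat" where
  "phi B i b = the_enat (string_len (f_op B i) b)"

lemma gl_op_carrier:
  assumes "gl_crystal n B"
  shows "e_op B i b = Some c \<Longrightarrow> i \<in> {1..<n} \<and> b \<in> carrier B \<and> c \<in> carrier B"
    and "f_op B i b = Some c \<Longrightarrow> i \<in> {1..<n} \<and> b \<in> carrier B \<and> c \<in> carrier B"
  using assms unfolding gl_crystal_def operator_on_def by (metis option.distinct(1))+

text \<open>
  Operators vanish off the carrier and at foreign indices, hence this and the next facts hold for
  arbitrary elements and indices; this avoids carrying membership conditions through every step.
\<close>
lemma gl_inverse:
  assumes "gl_crystal n B"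
  shows "e_op B i b = Some c \<longleftrightarrow> f_op B i c = Some b"
proof -
  have "i \<in> {1..<n} \<Longrightarrow> b \<in> carrier B \<Longrightarrow> c \<in> carrier B \<Longrightarrow> ?thesis"
    using assms unfolding gl_crystal_def by blast
  then show ?thesis using gl_op_carrier[OF assms] by metis
qed

lemma gl_wt:
  assumes "gl_crystal n B" "e_op B i b = Some c"
  shows "wt B c j = wt B b j + (std_basis i j - std_basis (i + 1) j)"
proof -
  have "wt B c j - wt B b j = std_basis i j - std_basis (i + 1) j"
    using assms gl_op_carrier(1)[OF assms] unfolding gl_crystal_def by blast
  then show ?thesis by simp
qed

lemma gl_string_len:
  assumes "gl_crystal n B"
  shows "string_len (e_op B i) b = enat (eps B i b)"
    and "string_len (f_op B i) b = enat (phi B i b)"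
proof -
  have "string_len (e_op B i) b \<noteq> \<infinity> \<and> string_len (f_op B i) b \<noteq> \<infinity>"
  proof (cases "i \<in> {1..<n} \<and> b \<in> carrier B")
    case True
    then show ?thesis using assms unfolding gl_crystal_def by blast
  next
    case False
    then have "e_op B i b = None" "f_op B i b = None"
      using gl_op_carrier[OF assms] by (meson not_None_eq)+
    then show ?thesis by (simp add: string_len_None)
  qed
  then show "string_len (e_op B i) b = enat (eps B i b)"
    and "string_len (f_op B i) b = enat (phi B i b)"
    by (auto simp: eps_def phi_def)
qed

lemma gl_eps_phi:
  assumes "gl_crystal n B"
  shows "e_op B i b = None \<longleftrightarrow> eps B i b = 0"
    and "f_op B i b = None \<longleftrightarrow> phi B i b = 0"
    and "e_op B i b = Some c \<Longrightarrow> eps B i b = Suc (eps B i c)"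
    and "e_op B i b = Some c \<Longrightarrow> phi B i c = Suc (phi B i b)"
    and "f_op B i b = Some c \<Longrightarrow> phi B i b = Suc (phi B i c)"
    and "f_op B i b = Some c \<Longrightarrow> eps B i c = Suc (eps B i b)"
proof -
  note sl = gl_string_len[OF assms] eSuc_enat zero_enat_def
  have e: "e_op B i b = Some c \<Longrightarrow> eps B i b = Suc (eps B i c)" for b c
    using string_len_Some[of "e_op B i" b c] by (simp add: sl)
  have f: "f_op B i b = Some c \<Longrightarrow> phi B i b = Suc (phi B i c)" for b c
    using string_len_Some[of "f_op B i" b c] by (simp add: sl)
  show "e_op B i b = None \<longleftrightarrow> eps B i b = 0"
    using e[of b] string_len_None[of "e_op B i" b] by (cases "e_op B i b") (auto simp: sl)
  show "f_op B i b = None \<longleftrightarrow> phi B i b = 0"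
    using f[of b] string_len_None[of "f_op B i" b] by (cases "f_op B i b") (auto simp: sl)
  show "e_op B i b = Some c \<Longrightarrow> eps B i b = Suc (eps B i c)" by (rule e)
  show "f_op B i b = Some c \<Longrightarrow> phi B i b = Suc (phi B i c)" by (rule f)
  show "e_op B i b = Some c \<Longrightarrow> phi B i c = Suc (phi B i b)"
    using f[of c b] gl_inverse[OF assms] by blast
  show "f_op B i b = Some c \<Longrightarrow> eps B i c = Suc (eps B i b)"
    using e[of c b] gl_inverse[OF assms] by blast
qed

lemma otensor_simps [simp]:
  "None \<otimes> y = None" "x \<otimes> None = None" "Some b \<otimes> Some c = Some (b, c)"
  by (cases x; simp add: otensor_def)+

lemma otensor_eq_None [simp]: "x \<otimes> y = None \<longleftrightarrow> x = None \<or> y = None"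
  by (cases x; cases y) auto

lemma otensor_eq_Some [simp]:
  "x \<otimes> y = Some p \<longleftrightarrow> x = Some (fst p) \<and> y = Some (snd p)"
  "Some p = x \<otimes> y \<longleftrightarrow> x = Some (fst p) \<and> y = Some (snd p)"
  by (cases x; cases y; cases p; auto)+

lemma gl_tensor_carrier [simp]: "carrier (gl_tensor n B C) = carrier B \<times> carrier C"
  and gl_tensor_wt [simp]: "wt (gl_tensor n B C) (b, c) j = wt B b j + wt C c j"
  by (simp_all add: gl_tensor_def)

lemma gl_tensor_op:
  assumes "gl_crystal n B" "gl_crystal n C" "b \<in> carrier B" "c \<in> carrier C"
  shows "e_op (gl_tensor n B C) i (b, c) =
      (if eps B i b \<le> phi C i c then Some b \<otimes> e_op C i c else e_op B i b \<otimes> Some c)"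
    and "f_op (gl_tensor n B C) i (b, c) =
      (if eps B i b < phi C i c then Some b \<otimes> f_op C i c else f_op B i b \<otimes> Some c)"
proof -
  have none: "e_op B i b = None" "e_op C i c = None" "f_op B i b = None" "f_op C i c = None"
    if "i \<notin> {1..<n}"
    using that gl_op_carrier[OF assms(1)] gl_op_carrier[OF assms(2)] by (meson not_None_eq)+
  show "e_op (gl_tensor n B C) i (b, c) =
      (if eps B i b \<le> phi C i c then Some b \<otimes> e_op C i c else e_op B i b \<otimes> Some c)"
    and "f_op (gl_tensor n B C) i (b, c) =
      (if eps B i b < phi C i c then Some b \<otimes> f_op C i c else f_op B i b \<otimes> Some c)"
    using assms(3,4) none
    by (auto simp: gl_tensor_def gl_string_len[OF assms(1)] gl_string_len[OF assms(2)])
qed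

lemma gl_tensor_op_outside:
  assumes "p \<notin> carrier B \<times> carrier C \<or> i \<notin> {1..<n}"
  shows "e_op (gl_tensor n B C) i p = None" "f_op (gl_tensor n B C) i p = None"
  using assms by (cases p; auto simp: gl_tensor_def)+

lemma gl_tensor_op_carrier:
  assumes B: "gl_crystal n B" and C: "gl_crystal n C"
  shows "e_op (gl_tensor n B C) i p = Some q \<Longrightarrow> p \<in> carrier B \<times> carrier C \<and> q \<in> carrier B \<times> carrier C"
    and "f_op (gl_tensor n B C) i p = Some q \<Longrightarrow> p \<in> carrier B \<times> carrier C \<and> q \<in> carrier B \<times> carrier C"
proof -
  note ops = gl_op_carrier[OF B] gl_op_carrier[OF C]
  show "p \<in> carrier B \<times> carrier C \<and> q \<in> carrier B \<times> carrier C"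
    if pq: "e_op (gl_tensor n B C) i p = Some q"
  proof -
    have "p \<in> carrier B \<times> carrier C" using gl_tensor_op_outside pq by (metis option.distinct(1))
    then show ?thesis using pq ops
      by (cases p; cases q) (auto simp: gl_tensor_op(1)[OF B C] split: if_splits)
  qed
  show "p \<in> carrier B \<times> carrier C \<and> q \<in> carrier B \<times> carrier C"
    if pq: "f_op (gl_tensor n B C) i p = Some q"
  proof -
    have "p \<in> carrier B \<times> carrier C" using gl_tensor_op_outside pq by (metis option.distinct(1))
    then show ?thesis using pq ops
      by (cases p; cases q) (auto simp: gl_tensor_op(2)[OF B C] split: if_splits)
  qed
qed

text \<open>
  A tensor's \<open>i\<close>-string first changes the factor chosen by comparing \<open>\<epsilon>\<^sub>i(b)\<close> with \<open>\<phi>\<^sub>i(c)\<close>.  Applying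
  \<open>e\<^sub>i\<close> to \<open>b\<close> lowers \<open>\<epsilon>\<^sub>i(b)\<close> by one until it meets \<open>\<phi>\<^sub>i(c)\<close>, after which \<open>e\<^sub>i\<close> acts on \<open>c\<close>, where
  \<open>\<phi>\<^sub>i(c)\<close> grows and the comparison never switches back.  The excess of \<open>\<epsilon>\<^sub>i(b)\<close> over \<open>\<phi>\<^sub>i(c)\<close>
  therefore adds to \<open>\<epsilon>\<^sub>i(c)\<close>.  The argument for \<open>f\<^sub>i\<close> is the mirror image.
\<close>
lemma gl_tensor_string_len:
  assumes B: "gl_crystal n B" and C: "gl_crystal n C"
    and bc: "b \<in> carrier B" "c \<in> carrier C"
  shows "string_len (e_op (gl_tensor n B C) i) (b, c) =
      enat (eps C i c + (eps B i b - phi C i c))"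
    and "string_len (f_op (gl_tensor n B C) i) (b, c) =
      enat (phi B i b + (phi C i c - eps B i b))"
proof -
  note eB = gl_eps_phi[OF B] and eC = gl_eps_phi[OF C]
  note ops = gl_op_carrier[OF B] gl_op_carrier[OF C]
  let ?e = "e_op (gl_tensor n B C) i" and ?f = "f_op (gl_tensor n B C) i"
  show "string_len ?e (b, c) = enat (eps C i c + (eps B i b - phi C i c))" using bc
  proof (induction "eps B i b + eps C i c" arbitrary: b c rule: less_induct)
    case less
    note e = gl_tensor_op(1)[OF B C less.prems, of i]
    show ?case
    proof (cases "?e (b, c)")
      case None
      then show ?thesis using e eB(1)[of i b] eC(1)[of i c]
        by (auto simp: string_len_None zero_enat_def split: if_splits)
    next
      case (Some p)
      obtain b' c' where p: "p = (b', c')" by (cases p)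
      have "string_len ?e (b', c') = enat (eps C i c' + (eps B i b' - phi C i c'))"
        using e Some less.prems unfolding p
        by (intro less.hyps) (auto dest: eB(3,4) eC(3,4) ops split: if_splits)
      then show ?thesis using e Some string_len_Some[of ?e, OF Some] eB(3)[of i b b'] eB(4)[of i b b']
          eC(3)[of i c c'] eC(4)[of i c c'] unfolding p
        by (auto simp: eSuc_enat split: if_splits)
    qed
  qed
  show "string_len ?f (b, c) = enat (phi B i b + (phi C i c - eps B i b))" using bc
  proof (induction "phi B i b + phi C i c" arbitrary: b c rule: less_induct)
    case less
    note f = gl_tensor_op(2)[OF B C less.prems, of i]
    show ?case
    proof (cases "?f (b, c)")
      case None
      then show ?thesis using f eB(2)[of i b] eC(2)[of i c]
        by (auto simp: string_len_None zero_enat_def split: if_splits)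
    next
      case (Some p)
      obtain b' c' where p: "p = (b', c')" by (cases p)
      have "string_len ?f (b', c') = enat (phi B i b' + (phi C i c' - eps B i b'))"
        using f Some less.prems unfolding p
        by (intro less.hyps) (auto dest: eB(5,6) eC(5,6) ops split: if_splits)
      then show ?thesis using f Some string_len_Some[of ?f, OF Some] eB(5)[of i b b'] eB(6)[of i b b']
          eC(5)[of i c c'] eC(6)[of i c c'] unfolding p
        by (auto simp: eSuc_enat split: if_splits)
    qed
  qed
qed

lemma gl_tensor_eps_phi:
  assumes "gl_crystal n B" "gl_crystal n C" "b \<in> carrier B" "c \<in> carrier C"
  shows "eps (gl_tensor n B C) i (b, c) = eps C i c + (eps B i b - phi C i c)"
    and "phi (gl_tensor n B C) i (b, c) = phi B i b + (phi C i c - eps B i b)"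
  using gl_tensor_string_len[OF assms] by (simp_all add: eps_def phi_def)

text \<open>
  Moving along an \<open>i\<close>-edge in either factor changes \<open>\<epsilon>\<^sub>i(b)\<close> or \<open>\<phi>\<^sub>i(c)\<close> by one, and this is exactly the
  difference between the weak inequality in the rule for \<open>e\<^sub>i\<close> and the strict one in the rule for
  \<open>f\<^sub>i\<close>, so the reverse operator acts on the same factor.
\<close>
lemma gl_tensor_inverse:
  assumes B: "gl_crystal n B" and C: "gl_crystal n C"
  shows "e_op (gl_tensor n B C) i p = Some q \<longleftrightarrow> f_op (gl_tensor n B C) i q = Some p"
proof -
  note eB = gl_eps_phi[OF B] and eC = gl_eps_phi[OF C]
  note inv = gl_inverse[OF B] gl_inverse[OF C]
  have "e_op (gl_tensor n B C) i (b, c) = Some (b', c') \<longleftrightarrow>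
        f_op (gl_tensor n B C) i (b', c') = Some (b, c)"
    if bc: "b \<in> carrier B" "c \<in> carrier C" "b' \<in> carrier B" "c' \<in> carrier C" for b c b' c'
    using eB(3,4)[of i b b'] eC(3,4)[of i c c'] inv(1)[of i b b'] inv(2)[of i c c']
    by (auto simp: gl_tensor_op[OF B C] bc)
  note on_carrier = this
  obtain b c b' c' where p: "p = (b, c)" and q: "q = (b', c')" by (cases p; cases q)
  show ?thesis
  proof (cases "b \<in> carrier B \<and> c \<in> carrier C \<and> b' \<in> carrier B \<and> c' \<in> carrier C")
    case True
    then show ?thesis unfolding p q by (intro on_carrier) auto
  next
    case False
    then show ?thesis unfolding p q
      using gl_tensor_op_carrier[OF B C, of i "(b, c)" "(b', c')"]
        gl_tensor_op_carrier[OF B C, of i "(b', c')" "(b, c)"] by auto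
  qed
qed

theorem gl_crystal_gl_tensor:
  assumes B: "gl_crystal n B" and C: "gl_crystal n C"
  shows "gl_crystal n (gl_tensor n B C)"
proof -
  let ?X = "gl_tensor n B C"
  have ne: "carrier ?X \<noteq> {}"
    using B C by (auto simp: gl_crystal_def)
  have wt0: "wt ?X p j = 0" if "p \<in> carrier ?X" "j \<notin> {1..n}" for p j
  proof -
    have "wt B b j = 0" if "b \<in> carrier B" for b
      using B \<open>j \<notin> {1..n}\<close> that unfolding gl_crystal_def by blast
    moreover have "wt C c j = 0" if "c \<in> carrier C" for c
      using C \<open>j \<notin> {1..n}\<close> that unfolding gl_crystal_def by blast
    ultimately show ?thesis using that(1) by (cases p) auto
  qed
  have on: "operator_on (carrier ?X) (e_op ?X i)" "operator_on (carrier ?X) (f_op ?X i)" for i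
    using gl_tensor_op_carrier[OF B C, of i] gl_tensor_op_outside[of _ B C i n]
    unfolding operator_on_def gl_tensor_carrier by blast+
  have wtd: "wt ?X q j - wt ?X p j = std_basis i j - std_basis (i + 1) j"
    if pq: "e_op ?X i p = Some q" for i p q j
  proof -
    obtain b c where p: "p = (b, c)" by (cases p)
    have "b \<in> carrier B" "c \<in> carrier C"
      using gl_tensor_op_carrier(1)[OF B C pq] p by auto
    then show ?thesis using pq gl_wt[OF B, of i b _ j] gl_wt[OF C, of i c _ j]
      by (cases q) (auto simp: p gl_tensor_op(1)[OF B C] split: if_splits)
  qed
  have fin: "string_len (e_op ?X i) p \<noteq> \<infinity> \<and> string_len (f_op ?X i) p \<noteq> \<infinity> \<and>
      int (the_enat (string_len (f_op ?X i) p)) - int (the_enat (string_len (e_op ?X i) p))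
        = wt ?X p i - wt ?X p (i + 1)" if "p \<in> carrier ?X" "i \<in> {1..<n}" for p i
  proof -
    obtain b c where p: "p = (b, c)" by (cases p)
    have bc: "b \<in> carrier B" "c \<in> carrier C" using that p by auto
    have "int (phi B i b) - int (eps B i b) = wt B b i - wt B b (i + 1)"
      using B bc that(2) unfolding gl_crystal_def eps_def phi_def by blast
    moreover have "int (phi C i c) - int (eps C i c) = wt C c i - wt C c (i + 1)"
      using C bc that(2) unfolding gl_crystal_def eps_def phi_def by blast
    ultimately show ?thesis
      unfolding p by (auto simp: gl_tensor_string_len[OF B C bc])
  qed
  show ?thesis
    unfolding gl_crystal_def
    by (intro conjI ballI allI impI;
        (rule ne wt0 on gl_tensor_inverse[OF B C] wtd fin[THEN conjunct1]
           fin[THEN conjunct2, THEN conjunct1] fin[THEN conjunct2, THEN conjunct2]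
           gl_tensor_op_outside[OF disjI2])?; assumption?)
qed


section \<open>Consequences of the axioms of \<open>\<qq>\<^sub>n\<^sup>+\<close>-crystals\<close>

lemma string_len_eq_0_iff: "string_len g b = 0 \<longleftrightarrow> g b = None"
  by (cases "g b") (simp_all add: string_len_None string_len_Some)

text \<open>
  Axioms (P3) and (Q3) prescribe whether a sum of two string lengths is zero or one.  For a mutually inverse pair
  \<open>(g, h)\<close> this is a condition on single applications: if \<open>g b = c\<close> then \<open>h c = b\<close>, so the
  "exactly one" condition at \<open>c\<close> forbids \<open>g c\<close>, and no string is longer than one edge.
\<close>
lemma string_len_sum_iff:
  assumes inv: "\<And>b c. g b = Some c \<longleftrightarrow> h c = Some b"
    and on: "\<And>b c. g b = Some c \<Longrightarrow> b \<in> A \<and> c \<in> A"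
  shows "(\<forall>b\<in>A. string_len g b + string_len h b = (if P b then 0 else 1)) \<longleftrightarrow>
    (\<forall>b\<in>A. if P b then g b = None \<and> h b = None else (g b = None) \<noteq> (h b = None))"
    (is "?L \<longleftrightarrow> ?R")
proof
  have two: "eSuc x + eSuc y \<noteq> 1" for x y
    by (metis add_eq_0_iff_both_eq_0 eSuc_inject eSuc_plus_1 iadd_Suc_right eSuc_ne_0 one_eSuc)
  assume L: ?L
  show ?R
  proof
    fix b assume "b \<in> A"
    with L have "string_len g b + string_len h b = (if P b then 0 else 1)" by blast
    then show "if P b then g b = None \<and> h b = None else (g b = None) \<noteq> (h b = None)"
      by (cases "g b"; cases "h b")
        (auto simp: string_len_None string_len_Some two split: if_splits)
  qed
next
  assume R: ?R
  show ?L
  proof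
    fix b assume b: "b \<in> A"
    have g1: "string_len g b = 1" if "g b = Some c" for c
    proof -
      have "h c = Some b" "c \<in> A" using that inv on by auto
      then have "g c = None" using R by (auto split: if_splits)
      then show ?thesis using that by (simp add: string_len_Some string_len_None one_eSuc)
    qed
    have h1: "string_len h b = 1" if "h b = Some c" for c
    proof -
      have "g c = Some b" "c \<in> A" using that inv on by auto
      then have "h c = None" using R by (auto split: if_splits)
      then show ?thesis using that by (simp add: string_len_Some string_len_None one_eSuc)
    qed
    show "string_len g b + string_len h b = (if P b then 0 else 1)"
      using R b g1 h1 by (cases "g b"; cases "h b") (auto simp: string_len_None split: if_splits)
  qed
qed

text \<open>
  Converts statements about string lengths of \<open>e\<^sub>0, f\<^sub>0\<close> and of the barred operators into
  statements about which of them vanish.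
\<close>
lemma string_len_toggle:
  assumes sum: "string_len g b + string_len h b = (if P then 0 else 1)"
  shows "string_len g b = (if g b = None then 0 else 1)"
    and "string_len h b = (if h b = None then 0 else 1)"
proof -
  have "x = (if x = 0 then 0 else 1)" if "x + y = (if P then 0 else 1)" for x y :: enat
  proof (cases P)
    case False
    then have "x + y = 1" using that by simp
    then show ?thesis by (cases x; cases y) (auto simp: one_enat_def zero_enat_def)
  qed (use that in auto)
  from this[OF sum] this[of "string_len h b" "string_len g b"] sum
  show "string_len g b = (if g b = None then 0 else 1)"
    and "string_len h b = (if h b = None then 0 else 1)"
    by (simp_all add: string_len_eq_0_iff add.commute)
qed

lemma qplus_q: "qplus_crystal n B \<Longrightarrow> q_crystal n B"
  by (simp add: qplus_crystal_def)

lemma qplus_gl: "qplus_crystal n B \<Longrightarrow> gl_crystal n B"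
  by (simp add: qplus_crystal_def q_crystal_def)

lemma qplus_wt_nonneg: "qplus_crystal n B \<Longrightarrow> b \<in> carrier B \<Longrightarrow> 0 \<le> wt B b j"
  by (simp add: qplus_crystal_def q_crystal_def)

lemma zero_carrier:
  assumes "qplus_crystal n B"
  shows "e_zero B b = Some c \<Longrightarrow> b \<in> carrier B \<and> c \<in> carrier B"
    and "f_zero B b = Some c \<Longrightarrow> b \<in> carrier B \<and> c \<in> carrier B"
  using assms unfolding qplus_crystal_def operator_on_def by (metis option.distinct(1))+

lemma zero_inverse:
  assumes "qplus_crystal n B"
  shows "e_zero B b = Some c \<longleftrightarrow> f_zero B c = Some b"
proof -
  have "b \<in> carrier B \<Longrightarrow> c \<in> carrier B \<Longrightarrow> ?thesis"
    using assms unfolding qplus_crystal_def by blast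
  then show ?thesis using zero_carrier[OF assms] by metis
qed

text \<open>
  Stated symmetrically in \<open>e\<^sub>0\<close> and \<open>f\<^sub>0\<close>, since the barred operators of a tensor product use both.
\<close>
lemma zero_preserves:
  assumes B: "qplus_crystal n B" and bc: "e_zero B b = Some c \<or> f_zero B b = Some c"
  shows "wt B c = wt B b"
    and "eps B i c = eps B i b" and "phi B i c = phi B i b"
    and "e_bar B c = None \<longleftrightarrow> e_bar B b = None"
    and "f_bar B c = None \<longleftrightarrow> f_bar B b = None"
proof -
  have *: "wt B c = wt B b \<and> eps B i c = eps B i b \<and> phi B i c = phi B i b \<and>
    (e_bar B c = None \<longleftrightarrow> e_bar B b = None) \<and> (f_bar B c = None \<longleftrightarrow> f_bar B b = None)"
    if e: "e_zero B b = Some c" for b c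
  proof -
    have bc: "b \<in> carrier B" "c \<in> carrier B" using zero_carrier(1)[OF B e] by auto
    have w: "wt B b = wt B c"
      and s: "i \<in> {1..<n} \<Longrightarrow> string_len (e_op B i) b = string_len (e_op B i) c \<and>
                        string_len (f_op B i) b = string_len (f_op B i) c"
      and t: "2 \<le> n \<Longrightarrow> string_len (e_bar B) b = string_len (e_bar B) c \<and>
                     string_len (f_bar B) b = string_len (f_bar B) c"
      using B bc e unfolding qplus_crystal_def by blast+
    have "e_bar B x = None \<and> f_bar B x = None" if "\<not> 2 \<le> n" for x
      using qplus_q[OF B] that unfolding q_crystal_def by auto
    moreover have "e_op B i x = None \<and> f_op B i x = None" if "i \<notin> {1..<n}" for x
      using qplus_gl[OF B] that unfolding gl_crystal_def by blast
    ultimately show ?thesis using w s t unfolding eps_def phi_def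
      by (metis string_len_None string_len_eq_0_iff)
  qed
  from bc have "wt B c = wt B b \<and> eps B i c = eps B i b \<and> phi B i c = phi B i b \<and>
    (e_bar B c = None \<longleftrightarrow> e_bar B b = None) \<and> (f_bar B c = None \<longleftrightarrow> f_bar B b = None)"
    using *[of b c] *[of c b] zero_inverse[OF B] by auto
  then show "wt B c = wt B b"
    and "eps B i c = eps B i b" and "phi B i c = phi B i b"
    and "e_bar B c = None \<longleftrightarrow> e_bar B b = None"
    and "f_bar B c = None \<longleftrightarrow> f_bar B b = None" by auto
qed

lemma zero_exactly_one:
  assumes B: "qplus_crystal n B" and b: "b \<in> carrier B"
  shows "wt B b 1 = 0 \<Longrightarrow> e_zero B b = None" and "wt B b 1 = 0 \<Longrightarrow> f_zero B b = None"
    and "wt B b 1 \<noteq> 0 \<Longrightarrow> e_zero B b = None \<longleftrightarrow> f_zero B b \<noteq> None"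
proof -
  have "\<forall>b\<in>carrier B. string_len (e_zero B) b + string_len (f_zero B) b =
        (if wt B b 1 = 0 then 0 else 1)"
    using B unfolding qplus_crystal_def by blast
  then have "if wt B b 1 = 0 then e_zero B b = None \<and> f_zero B b = None
      else (e_zero B b = None) \<noteq> (f_zero B b = None)"
    using string_len_sum_iff[OF zero_inverse[OF B] zero_carrier(1)[OF B], of "\<lambda>b. wt B b 1 = 0"] b
    by blast
  then show "wt B b 1 = 0 \<Longrightarrow> e_zero B b = None" and "wt B b 1 = 0 \<Longrightarrow> f_zero B b = None"
    and "wt B b 1 \<noteq> 0 \<Longrightarrow> e_zero B b = None \<longleftrightarrow> f_zero B b \<noteq> None" by auto
qed

lemma bar_carrier:
  assumes "qplus_crystal n B"
  shows "e_bar B b = Some c \<Longrightarrow> 2 \<le> n \<and> b \<in> carrier B \<and> c \<in> carrier B"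
    and "f_bar B b = Some c \<Longrightarrow> 2 \<le> n \<and> b \<in> carrier B \<and> c \<in> carrier B"
  using qplus_q[OF assms] unfolding q_crystal_def operator_on_def
  by (metis option.distinct(1) not_less)+

lemma bar_inverse:
  assumes "qplus_crystal n B"
  shows "e_bar B b = Some c \<longleftrightarrow> f_bar B c = Some b"
proof -
  have "2 \<le> n \<Longrightarrow> b \<in> carrier B \<Longrightarrow> c \<in> carrier B \<Longrightarrow> ?thesis"
    using qplus_q[OF assms] unfolding q_crystal_def by blast
  then show ?thesis using bar_carrier[OF assms] by metis
qed

lemma bar_wt:
  assumes B: "qplus_crystal n B"
  shows "e_bar B b = Some c \<Longrightarrow> wt B c j = wt B b j + (std_basis 1 j - std_basis 2 j)"
    and "f_bar B b = Some c \<Longrightarrow> wt B c j = wt B b j - (std_basis 1 j - std_basis 2 j)"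
proof -
  have *: "wt B c j - wt B b j = std_basis 1 j - std_basis 2 j" if e: "e_bar B b = Some c" for b c
    using qplus_q[OF B] bar_carrier(1)[OF B e] e unfolding q_crystal_def by blast
  show "e_bar B b = Some c \<Longrightarrow> wt B c j = wt B b j + (std_basis 1 j - std_basis 2 j)"
    using *[of b c] by simp
  show "f_bar B b = Some c \<Longrightarrow> wt B c j = wt B b j - (std_basis 1 j - std_basis 2 j)"
    using *[of c b] bar_inverse[OF B, of c b] by simp
qed

lemma bar_preserves:
  assumes B: "qplus_crystal n B" and bc: "e_bar B b = Some c \<or> f_bar B b = Some c"
    and i: "3 \<le> i"
  shows "eps B i c = eps B i b" and "phi B i c = phi B i b"
proof -
  have *: "eps B i c = eps B i b \<and> phi B i c = phi B i b" if e: "e_bar B b = Some c" for b c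
  proof (cases "i < n")
    case True
    then have "string_len (e_op B i) b = string_len (e_op B i) c \<and>
               string_len (f_op B i) b = string_len (f_op B i) c"
      using qplus_q[OF B] bar_carrier(1)[OF B e] e i unfolding q_crystal_def
      by (meson atLeastLessThan_iff)
    then show ?thesis by (simp add: eps_def phi_def)
  next
    case False
    then have "e_op B i x = None \<and> f_op B i x = None" for x
      using qplus_gl[OF B] unfolding gl_crystal_def by (meson atLeastLessThan_iff)
    then show ?thesis by (simp add: eps_def phi_def string_len_None)
  qed
  have "eps B i c = eps B i b \<and> phi B i c = phi B i b"
    using bc *[of b c] *[of c b] bar_inverse[OF B] by auto
  then show "eps B i c = eps B i b" and "phi B i c = phi B i b" by auto
qed

lemma bar_exactly_one:
  assumes B: "qplus_crystal n B" and b: "b \<in> carrier B" and n: "2 \<le> n"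
  shows "wt B b 1 = 0 \<Longrightarrow> wt B b 2 = 0 \<Longrightarrow> e_bar B b = None"
    and "wt B b 1 = 0 \<Longrightarrow> wt B b 2 = 0 \<Longrightarrow> f_bar B b = None"
    and "wt B b 1 \<noteq> 0 \<or> wt B b 2 \<noteq> 0 \<Longrightarrow> e_bar B b = None \<longleftrightarrow> f_bar B b \<noteq> None"
proof -
  have "\<forall>b\<in>carrier B. string_len (e_bar B) b + string_len (f_bar B) b =
        (if wt B b 1 = 0 \<and> wt B b 2 = 0 then 0 else 1)"
    using qplus_q[OF B] n unfolding q_crystal_def by blast
  then have "if wt B b 1 = 0 \<and> wt B b 2 = 0 then e_bar B b = None \<and> f_bar B b = None
      else (e_bar B b = None) \<noteq> (f_bar B b = None)"
    using string_len_sum_iff[OF bar_inverse[OF B], of "carrier B" "\<lambda>b. wt B b 1 = 0 \<and> wt B b 2 = 0"]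
      bar_carrier(1)[OF B] b
    by blast
  then show "wt B b 1 = 0 \<Longrightarrow> wt B b 2 = 0 \<Longrightarrow> e_bar B b = None"
    and "wt B b 1 = 0 \<Longrightarrow> wt B b 2 = 0 \<Longrightarrow> f_bar B b = None"
    and "wt B b 1 \<noteq> 0 \<or> wt B b 2 \<noteq> 0 \<Longrightarrow> e_bar B b = None \<longleftrightarrow> f_bar B b \<noteq> None"
    by (auto split: if_splits)
qed

section \<open>Maps compatible with \<open>i\<close>-strings\<close>

text \<open>
  The new operators on a tensor product are assembled from operators on the factors by composition,
  by \<open>\<otimes>\<close>, and by case distinctions.  (P2), (Q2) and the parts of (P1), (Q1) on string lengths are
  thus proved for a class of maps with these closure properties.  Two layers are needed: \<open>e\<^sub>0\<close>
  preserves \<open>\<epsilon>\<^sub>1\<close> and \<open>\<phi>\<^sub>1\<close> but need not commute with \<open>e\<^sub>1\<close>.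
\<close>
definition string_preserving :: "('b, 'z) gl_data_scheme \<Rightarrow> nat \<Rightarrow> ('b \<Rightarrow> 'b option) \<Rightarrow> bool" where
  "string_preserving B i u \<longleftrightarrow>
     (\<forall>b\<in>carrier B. \<forall>b'. u b = Some b' \<longrightarrow>
        b' \<in> carrier B \<and> eps B i b' = eps B i b \<and> phi B i b' = phi B i b)"

text \<open>
  Commutation is required only where \<open>e\<^sub>i\<close> is defined.  The rest of the commutation with \<open>e\<^sub>i\<close>
  and \<open>f\<^sub>i\<close> follows, because a string-preserving map cannot send an end of an \<open>i\<close>-string to an inner
  element, and \<open>f\<^sub>i\<close> inverts \<open>e\<^sub>i\<close>.
\<close>
definition equivariant :: "('b, 'z) gl_data_scheme \<Rightarrow> nat \<Rightarrow> ('b \<Rightarrow> 'b option) \<Rightarrow> bool" where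
  "equivariant B i u \<longleftrightarrow> string_preserving B i u \<and>
     (\<forall>b b1. e_op B i b = Some b1 \<longrightarrow> u b1 = Option.bind (u b) (e_op B i))"

lemma string_preservingI:
  assumes "\<And>b b'. b \<in> carrier B \<Longrightarrow> u b = Some b' \<Longrightarrow>
    b' \<in> carrier B \<and> eps B i b' = eps B i b \<and> phi B i b' = phi B i b"
  shows "string_preserving B i u"
  using assms unfolding string_preserving_def by blast

lemma string_preservingD:
  assumes "string_preserving B i u" "b \<in> carrier B" "u b = Some b'"
  shows "b' \<in> carrier B" "eps B i b' = eps B i b" "phi B i b' = phi B i b"
  using assms unfolding string_preserving_def by blast+

lemma equivariantD:
  assumes "equivariant B i u"
  shows "string_preserving B i u"
    and "e_op B i b = Some b1 \<Longrightarrow> u b1 = Option.bind (u b) (e_op B i)"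
  using assms unfolding equivariant_def by blast+

text \<open>
  Whether \<open>u\<close> vanishes is constant along an \<open>i\<close>-string.  Hence the side conditions of the tensor
  formulas, which ask whether composites vanish, are invariant under \<open>e\<^sub>i\<close>.
\<close>
lemma equivariant_None_iff:
  assumes B: "gl_crystal n B" and u: "equivariant B i u" and e: "e_op B i b = Some b1"
  shows "u b1 = None \<longleftrightarrow> u b = None"
proof (cases "u b")
  case (Some b')
  have "b \<in> carrier B" using gl_op_carrier(1)[OF B e] by blast
  then have "eps B i b' = eps B i b"
    using u Some unfolding equivariant_def string_preserving_def by blast
  then have "e_op B i b' \<noteq> None" using gl_eps_phi(1,3)[OF B, of i] e by auto
  then show ?thesis using equivariantD(2)[OF u e] Some by simp
qed (use equivariantD(2)[OF u e] in \<open>simp add: equivariant_def\<close>)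

lemma equivariant_imp_ops_commute:
  assumes B: "gl_crystal n B" and u: "equivariant B i u"
  shows "ops_commute (carrier B) (e_op B i) u" and "ops_commute (carrier B) (f_op B i) u"
proof -
  note inv = gl_inverse[OF B] and ep = gl_eps_phi[OF B]
  have pres: "eps B i b' = eps B i b \<and> phi B i b' = phi B i b"
    if "b \<in> carrier B" "u b = Some b'" for b b'
    using u that unfolding equivariant_def string_preserving_def by blast
  have step: "u b1 = Option.bind (u b) (e_op B i)" if "e_op B i b = Some b1" for b b1
    using u that unfolding equivariant_def by blast
  show "ops_commute (carrier B) (e_op B i) u" unfolding ops_commute_def
  proof
    fix b assume b: "b \<in> carrier B"
    show "Option.bind (e_op B i b) u = Option.bind (u b) (e_op B i)"
    proof (cases "e_op B i b")
      case None
      then have "e_op B i b' = None" if "u b = Some b'" for b'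
        using pres[OF b that] ep(1)[of i b] ep(1)[of i b'] by simp
      with None show ?thesis by (cases "u b") auto
    qed (simp add: step)
  qed
  show "ops_commute (carrier B) (f_op B i) u" unfolding ops_commute_def
  proof
    fix b assume b: "b \<in> carrier B"
    show "Option.bind (f_op B i b) u = Option.bind (u b) (f_op B i)"
    proof (cases "f_op B i b")
      case None
      then have "f_op B i b' = None" if "u b = Some b'" for b'
        using pres[OF b that] ep(2)[of i b] ep(2)[of i b'] by simp
      with None show ?thesis by (cases "u b") auto
    next
      case (Some a)
      then have e: "e_op B i a = Some b" using inv by blast
      show ?thesis
      proof (cases "u a")
        case None
        then show ?thesis using Some equivariant_None_iff[OF B u e] by simp
      next
        case (Some a')
        then obtain b' where b': "u b = Some b'" using equivariant_None_iff[OF B u e] by auto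
        then have "e_op B i a' = Some b'" using step[OF e] Some by simp
        then show ?thesis using \<open>f_op B i b = Some a\<close> b' Some inv[of i a' b'] by simp
      qed
    qed
  qed
qed

lemma equivariantI:
  assumes "gl_crystal n B" "string_preserving B i u" "ops_commute (carrier B) (e_op B i) u"
  shows "equivariant B i u"
  unfolding equivariant_def
proof (intro conjI allI impI assms(2))
  fix b b1 assume e: "e_op B i b = Some b1"
  then have "b \<in> carrier B" using gl_op_carrier(1)[OF assms(1)] by blast
  with assms(3) have "Option.bind (e_op B i b) u = Option.bind (u b) (e_op B i)"
    unfolding ops_commute_def by blast
  then show "u b1 = Option.bind (u b) (e_op B i)" using e by simp
qed

lemma equivariant_cong:
  assumes "gl_crystal n B" "equivariant B i u" "\<And>b. b \<in> carrier B \<Longrightarrow> v b = u b"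
  shows "equivariant B i v"
  unfolding equivariant_def
proof (intro conjI allI impI)
  show "string_preserving B i v"
  proof (rule string_preservingI)
    fix b b' assume b: "b \<in> carrier B" and "v b = Some b'"
    then have "u b = Some b'" using assms(3) by simp
    then show "b' \<in> carrier B \<and> eps B i b' = eps B i b \<and> phi B i b' = phi B i b"
      using string_preservingD[OF equivariantD(1)[OF assms(2)] b] by blast
  qed
  fix b b1 assume e: "e_op B i b = Some b1"
  then have "b \<in> carrier B" "b1 \<in> carrier B" using gl_op_carrier(1)[OF assms(1)] by blast+
  then show "v b1 = Option.bind (v b) (e_op B i)"
    using equivariantD(2)[OF assms(2) e] assms(3) by simp
qed

lemma string_preserving_Some: "string_preserving B i Some"
  by (simp add: string_preserving_def)

lemma string_preserving_if:
  "string_preserving B i u \<Longrightarrow> string_preserving B i v \<Longrightarrow>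
    string_preserving B i (\<lambda>b. if P b then u b else v b)"
  by (rule string_preservingI) (auto dest: string_preservingD split: if_splits)

lemma equivariant_Some: "equivariant B i Some"
  by (simp add: equivariant_def string_preserving_Some)

lemma equivariant_if:
  assumes "equivariant B i u" "equivariant B i v"
    and "\<And>b b1. e_op B i b = Some b1 \<Longrightarrow> P b1 \<longleftrightarrow> P b"
  shows "equivariant B i (\<lambda>b. if P b then u b else v b)"
  unfolding equivariant_def
proof (intro conjI allI impI)
  show "string_preserving B i (\<lambda>b. if P b then u b else v b)"
    using assms(1,2) by (simp add: equivariant_def string_preserving_if)
  fix b b1 assume e: "e_op B i b = Some b1"
  have "u b1 = Option.bind (u b) (e_op B i)" "v b1 = Option.bind (v b) (e_op B i)"
    using assms(1,2) e unfolding equivariant_def by blast+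
  then show "(if P b1 then u b1 else v b1) = Option.bind (if P b then u b else v b) (e_op B i)"
    by (simp add: assms(3)[OF e])
qed

lemma equivariant_bind:
  assumes B: "gl_crystal n B" and u: "equivariant B i u" and v: "equivariant B i v"
  shows "equivariant B i (\<lambda>b. Option.bind (u b) v)"
proof -
  have "string_preserving B i (\<lambda>b. Option.bind (u b) v)"
  proof (rule string_preservingI)
    fix b b' assume b: "b \<in> carrier B" and "Option.bind (u b) v = Some b'"
    then obtain a where a: "u b = Some a" "v a = Some b'" by (cases "u b") simp_all
    note a_str = string_preservingD[OF equivariantD(1)[OF u] b a(1)]
    show "b' \<in> carrier B \<and> eps B i b' = eps B i b \<and> phi B i b' = phi B i b"
      using a_str string_preservingD[OF equivariantD(1)[OF v] a_str(1) a(2)] by simp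
  qed
  moreover have "Option.bind (u b1) v = Option.bind (Option.bind (u b) v) (e_op B i)"
    if e: "e_op B i b = Some b1" for b b1
  proof (cases "u b")
    case None
    then show ?thesis using equivariant_None_iff[OF B u e] by simp
  next
    case (Some b')
    then obtain b1' where b1': "u b1 = Some b1'"
      using equivariant_None_iff[OF B u e] by auto
    then have "e_op B i b' = Some b1'" using equivariantD(2)[OF u e] Some by simp
    then have "v b1' = Option.bind (v b') (e_op B i)" using equivariantD(2)[OF v] by blast
    then show ?thesis using Some b1' by simp
  qed
  ultimately show ?thesis unfolding equivariant_def by blast
qed

lemma string_preserving_tensor:
  assumes "gl_crystal n B" "gl_crystal n C" "string_preserving B i u" "string_preserving C i v"
  shows "string_preserving (gl_tensor n B C) i (\<lambda>p. u (fst p) \<otimes> v (snd p))"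
proof (rule string_preservingI)
  fix p q assume p: "p \<in> carrier (gl_tensor n B C)" and "u (fst p) \<otimes> v (snd p) = Some q"
  then have q: "fst p \<in> carrier B" "snd p \<in> carrier C"
      "u (fst p) = Some (fst q)" "v (snd p) = Some (snd q)" by auto
  note B' = string_preservingD[OF assms(3) q(1,3)] and C' = string_preservingD[OF assms(4) q(2,4)]
  show "q \<in> carrier (gl_tensor n B C) \<and> eps (gl_tensor n B C) i q = eps (gl_tensor n B C) i p \<and>
      phi (gl_tensor n B C) i q = phi (gl_tensor n B C) i p"
    using gl_tensor_eps_phi[OF assms(1,2) q(1,2), of i]
      gl_tensor_eps_phi[OF assms(1,2) B'(1) C'(1), of i] B' C' by (cases q) simp
qed

lemma gl_tensor_e_op_cases:
  assumes B: "gl_crystal n B" and C: "gl_crystal n C"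
    and e: "e_op (gl_tensor n B C) i p = Some q"
  obtains (right) "eps B i (fst p) \<le> phi C i (snd p)" "fst q = fst p"
      "e_op C i (snd p) = Some (snd q)"
    | (left) "eps B i (fst p) > phi C i (snd p)" "e_op B i (fst p) = Some (fst q)" "snd q = snd p"
proof -
  obtain b c where p: "p = (b, c)" by (cases p)
  have "b \<in> carrier B" "c \<in> carrier C" using gl_tensor_op_carrier(1)[OF B C e] p by auto
  then show ?thesis using e that gl_tensor_op(1)[OF B C, of b c i] p
    by (auto split: if_splits)
qed

text \<open>
  Because \<open>u\<close> and \<open>v\<close> leave \<open>\<epsilon>\<^sub>i\<close> and \<open>\<phi>\<^sub>i\<close> alone, the comparison that decides on which factor
  \<open>e\<^sub>i\<close> acts has the same outcome before and after applying \<open>u \<otimes> v\<close>.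
\<close>
lemma equivariant_tensor:
  assumes B: "gl_crystal n B" and C: "gl_crystal n C"
    and u: "equivariant B i u" and v: "equivariant C i v"
  shows "equivariant (gl_tensor n B C) i (\<lambda>p. u (fst p) \<otimes> v (snd p))"
  unfolding equivariant_def
proof (intro conjI allI impI)
  have sp: "string_preserving B i u" "string_preserving C i v"
    using u v by (simp_all add: equivariant_def)
  show "string_preserving (gl_tensor n B C) i (\<lambda>p. u (fst p) \<otimes> v (snd p))"
    by (rule string_preserving_tensor[OF B C sp])
  fix p q assume e: "e_op (gl_tensor n B C) i p = Some q"
  have p: "fst p \<in> carrier B" "snd p \<in> carrier C"
    using gl_tensor_op_carrier(1)[OF B C e] by auto
  have op: "e_op (gl_tensor n B C) i (b, c) =
      (if eps B i (fst p) \<le> phi C i (snd p) then Some b \<otimes> e_op C i c else e_op B i b \<otimes> Some c)"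
    if "u (fst p) = Some b" "v (snd p) = Some c" for b c
    using gl_tensor_op(1)[OF B C, of b c i]
      string_preservingD[OF sp(1) p(1) that(1)] string_preservingD[OF sp(2) p(2) that(2)] by simp
  show "u (fst q) \<otimes> v (snd q) =
      Option.bind (u (fst p) \<otimes> v (snd p)) (e_op (gl_tensor n B C) i)"
  proof (cases rule: gl_tensor_e_op_cases[OF B C e, case_names right left])
    case right
    have "v (snd q) = Option.bind (v (snd p)) (e_op C i)"
      using v right(3) unfolding equivariant_def by blast
    then show ?thesis
      using right(1,2) op by (cases "u (fst p)"; cases "v (snd p)") auto
  next
    case left
    have "u (fst q) = Option.bind (u (fst p)) (e_op B i)"
      using u left(2) unfolding equivariant_def by blast
    then show ?thesis
      using left(1,3) op by (cases "u (fst p)"; cases "v (snd p)") auto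
  qed
qed

lemma zero_string_preserving:
  assumes B: "qplus_crystal n B"
  shows "string_preserving B i (e_zero B)" and "string_preserving B i (f_zero B)"
  by (intro string_preservingI; simp add: zero_preserves[OF B] zero_carrier[OF B])+

lemma zero_equivariant:
  assumes B: "qplus_crystal n B" and i: "2 \<le> i"
  shows "equivariant B i (e_zero B)" and "equivariant B i (f_zero B)"
proof -
  note gl = qplus_gl[OF B]
  have "ops_commute (carrier B) (e_op B i) (e_zero B) \<and> ops_commute (carrier B) (e_op B i) (f_zero B)"
  proof (cases "i < n")
    case True
    then show ?thesis using B i unfolding qplus_crystal_def by auto
  next
    case False
    then have "e_op B i = (\<lambda>b. None)" using gl unfolding gl_crystal_def by auto
    then show ?thesis by (simp add: ops_commute_def)
  qed
  then show "equivariant B i (e_zero B)" and "equivariant B i (f_zero B)"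
    by (auto intro: equivariantI[OF gl] zero_string_preserving[OF B])
qed

lemma bar_equivariant:
  assumes B: "qplus_crystal n B" and i: "3 \<le> i"
  shows "equivariant B i (e_bar B)" and "equivariant B i (f_bar B)"
proof -
  note gl = qplus_gl[OF B]
  have sp: "string_preserving B i (e_bar B)" "string_preserving B i (f_bar B)"
    by (intro string_preservingI; simp add: bar_preserves[OF B _ i] bar_carrier[OF B])+
  have "ops_commute (carrier B) (e_op B i) (e_bar B) \<and> ops_commute (carrier B) (e_op B i) (f_bar B)"
  proof (cases "i < n")
    case True
    then show ?thesis using qplus_q[OF B] i unfolding q_crystal_def by auto
  next
    case False
    then have "e_op B i = (\<lambda>b. None)" using gl unfolding gl_crystal_def by auto
    then show ?thesis by (simp add: ops_commute_def)
  qed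
  then show "equivariant B i (e_bar B)" and "equivariant B i (f_bar B)"
    by (auto intro: equivariantI[OF gl] sp)
qed

section \<open>The structure on the tensor product\<close>

definition tensor_e_zero ::
  "'b qplus_data \<Rightarrow> 'c qplus_data \<Rightarrow> 'b \<times> 'c \<Rightarrow> ('b \<times> 'c) option" where
  "tensor_e_zero B C p =
     (if wt B (fst p) 1 \<noteq> 0 then e_zero B (fst p) \<otimes> Some (snd p)
      else Some (fst p) \<otimes> e_zero C (snd p))"

definition tensor_f_zero ::
  "'b qplus_data \<Rightarrow> 'c qplus_data \<Rightarrow> 'b \<times> 'c \<Rightarrow> ('b \<times> 'c) option" where
  "tensor_f_zero B C p =
     (if wt B (fst p) 1 \<noteq> 0 then f_zero B (fst p) \<otimes> Some (snd p)
      else Some (fst p) \<otimes> f_zero C (snd p))"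

text \<open>
  Writing these formulas through \<open>fst\<close> and \<open>snd\<close> makes each branch literally of the form
  \<open>\<lambda>p. u (fst p) \<otimes> v (snd p)\<close>, as required by \<open>equivariant_tensor\<close>.
\<close>
definition tensor_e_bar ::
  "'b qplus_data \<Rightarrow> 'c qplus_data \<Rightarrow> 'b \<times> 'c \<Rightarrow> ('b \<times> 'c) option" where
  "tensor_e_bar B C p =
     (if wt B (fst p) 1 = 0 \<and> wt B (fst p) 2 = 0 then Some (fst p) \<otimes> e_bar C (snd p)
      else if wt B (fst p) 1 = 0 \<and> Option.bind (e_bar B (fst p)) (f_zero B) \<noteq> None
              \<and> e_zero C (snd p) \<noteq> None then
        Option.bind (e_bar B (fst p)) (f_zero B) \<otimes> e_zero C (snd p)
      else if wt B (fst p) 1 = 0 \<and> Option.bind (e_bar B (fst p)) (e_zero B) \<noteq> None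
              \<and> f_zero C (snd p) \<noteq> None then
        Option.bind (e_bar B (fst p)) (e_zero B) \<otimes> f_zero C (snd p)
      else e_bar B (fst p) \<otimes> Some (snd p))"

definition tensor_f_bar ::
  "'b qplus_data \<Rightarrow> 'c qplus_data \<Rightarrow> 'b \<times> 'c \<Rightarrow> ('b \<times> 'c) option" where
  "tensor_f_bar B C p =
     (if wt B (fst p) 1 = 0 \<and> wt B (fst p) 2 = 0 then Some (fst p) \<otimes> f_bar C (snd p)
      else if wt B (fst p) 1 = 1 \<and> Option.bind (f_zero B (fst p)) (f_bar B) \<noteq> None
              \<and> e_zero C (snd p) \<noteq> None then
        Option.bind (f_zero B (fst p)) (f_bar B) \<otimes> e_zero C (snd p)
      else if wt B (fst p) 1 = 1 \<and> Option.bind (e_zero B (fst p)) (f_bar B) \<noteq> None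
              \<and> f_zero C (snd p) \<noteq> None then
        Option.bind (e_zero B (fst p)) (f_bar B) \<otimes> f_zero C (snd p)
      else f_bar B (fst p) \<otimes> Some (snd p))"

definition tensor_structure ::
  "nat \<Rightarrow> 'b qplus_data \<Rightarrow> 'c qplus_data \<Rightarrow> ('b \<times> 'c) qplus_data" where
  "tensor_structure n B C =
     (let X = gl_tensor n B C;
          on_X = (\<lambda>g p. if p \<in> carrier X then g p else None)
      in \<lparr>carrier = carrier X, wt = wt X, e_op = e_op X, f_op = f_op X,
          e_bar = (if 2 \<le> n then on_X (tensor_e_bar B C) else (\<lambda>p. None)),
          f_bar = (if 2 \<le> n then on_X (tensor_f_bar B C) else (\<lambda>p. None)),
          e_zero = on_X (tensor_e_zero B C),
          f_zero = on_X (tensor_f_zero B C)\<rparr>)"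

lemma tensor_structure_simps [simp]:
  "carrier (tensor_structure n B C) = carrier B \<times> carrier C"
  "wt (tensor_structure n B C) = wt (gl_tensor n B C)"
  "e_op (tensor_structure n B C) = e_op (gl_tensor n B C)"
  "f_op (tensor_structure n B C) = f_op (gl_tensor n B C)"
  "e_bar (tensor_structure n B C) p =
     (if 2 \<le> n \<and> p \<in> carrier B \<times> carrier C then tensor_e_bar B C p else None)"
  "f_bar (tensor_structure n B C) p =
     (if 2 \<le> n \<and> p \<in> carrier B \<times> carrier C then tensor_f_bar B C p else None)"
  "e_zero (tensor_structure n B C) p =
     (if p \<in> carrier B \<times> carrier C then tensor_e_zero B C p else None)"
  "f_zero (tensor_structure n B C) p =
     (if p \<in> carrier B \<times> carrier C then tensor_f_zero B C p else None)"
  by (auto simp: tensor_structure_def Let_def)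

lemma tensor_zero_string_preserving:
  assumes B: "qplus_crystal n B" and C: "qplus_crystal n C"
  shows "string_preserving (gl_tensor n B C) i (tensor_e_zero B C)"
    and "string_preserving (gl_tensor n B C) i (tensor_f_zero B C)"
  unfolding tensor_e_zero_def[abs_def] tensor_f_zero_def[abs_def]
  by (intro string_preserving_if string_preserving_tensor qplus_gl[OF B] qplus_gl[OF C]
      string_preserving_Some zero_string_preserving[OF B] zero_string_preserving[OF C])+

lemma gl_tensor_invariant_weight:
  assumes B: "gl_crystal n B" and C: "gl_crystal n C"
    and "e_op (gl_tensor n B C) i p = Some q" "j < i"
  shows "wt B (fst q) j = wt B (fst p) j"
proof (cases rule: gl_tensor_e_op_cases[OF B C assms(3), case_names right left])
  case left
  then show ?thesis using gl_wt[OF B left(2), of j] assms(4) by (simp add: std_basis_def)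
qed simp

lemma gl_tensor_invariant_None:
  assumes B: "gl_crystal n B" and C: "gl_crystal n C"
    and e: "e_op (gl_tensor n B C) i p = Some q"
  shows "equivariant B i u \<Longrightarrow> u (fst q) = None \<longleftrightarrow> u (fst p) = None"
    and "equivariant C i v \<Longrightarrow> v (snd q) = None \<longleftrightarrow> v (snd p) = None"
  by (cases rule: gl_tensor_e_op_cases[OF B C e, case_names right left];
      auto dest: equivariant_None_iff[OF B] equivariant_None_iff[OF C])+

lemma tensor_zero_equivariant:
  assumes B: "qplus_crystal n B" and C: "qplus_crystal n C" and i: "2 \<le> i"
  shows "equivariant (gl_tensor n B C) i (tensor_e_zero B C)"
    and "equivariant (gl_tensor n B C) i (tensor_f_zero B C)"
proof -
  note gl = qplus_gl[OF B] qplus_gl[OF C]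
  have w: "wt B (fst q) 1 \<noteq> 0 \<longleftrightarrow> wt B (fst p) 1 \<noteq> 0"
    if "e_op (gl_tensor n B C) i p = Some q" for p q
    using gl_tensor_invariant_weight[OF gl that, of 1] i by simp
  show "equivariant (gl_tensor n B C) i (tensor_e_zero B C)"
    and "equivariant (gl_tensor n B C) i (tensor_f_zero B C)"
    unfolding tensor_e_zero_def[abs_def] tensor_f_zero_def[abs_def]
    by (intro equivariant_if equivariant_tensor[OF gl] equivariant_Some
        zero_equivariant[OF B i] zero_equivariant[OF C i] w; assumption)+
qed

text \<open>
  For \<open>i \<ge> 3\<close> the first two weight coordinates of \<open>b\<close> do not change under \<open>e\<^sub>i\<close>, and neither does the
  vanishing of the composites in the case conditions; so one branch of the formula applies along
  a whole \<open>i\<close>-string, and each branch is a tensor of equivariant maps.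
\<close>
lemma tensor_bar_equivariant:
  assumes B: "qplus_crystal n B" and C: "qplus_crystal n C" and i: "3 \<le> i"
  shows "equivariant (gl_tensor n B C) i (tensor_e_bar B C)"
    and "equivariant (gl_tensor n B C) i (tensor_f_bar B C)"
proof -
  note gl = qplus_gl[OF B] qplus_gl[OF C]
  from i have i2: "2 \<le> i" by simp
  note eq = equivariant_Some zero_equivariant[OF B i2] zero_equivariant[OF C i2]
    bar_equivariant[OF B i] bar_equivariant[OF C i]
  note comp = equivariant_bind[OF gl(1)]
  have w: "wt B (fst q) 1 = wt B (fst p) 1" "wt B (fst q) 2 = wt B (fst p) 2"
    if "e_op (gl_tensor n B C) i p = Some q" for p q
    using gl_tensor_invariant_weight[OF gl that] i by simp_all
  note none = gl_tensor_invariant_None[OF gl]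
  show "equivariant (gl_tensor n B C) i (tensor_e_bar B C)"
    unfolding tensor_e_bar_def[abs_def]
  proof (intro equivariant_if equivariant_tensor[OF gl] comp eq)
    fix p q assume e: "e_op (gl_tensor n B C) i p = Some q"
    note n1 = none(1)[OF e comp[OF eq(6) eq(3)]] none(1)[OF e comp[OF eq(6) eq(2)]]
      none(2)[OF e eq(4)] none(2)[OF e eq(5)]
    show "(wt B (fst q) 1 = 0 \<and> wt B (fst q) 2 = 0) = (wt B (fst p) 1 = 0 \<and> wt B (fst p) 2 = 0)"
      "(wt B (fst q) 1 = 0 \<and> Option.bind (e_bar B (fst q)) (f_zero B) \<noteq> None \<and>
          e_zero C (snd q) \<noteq> None) =
       (wt B (fst p) 1 = 0 \<and> Option.bind (e_bar B (fst p)) (f_zero B) \<noteq> None \<and>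
          e_zero C (snd p) \<noteq> None)"
      "(wt B (fst q) 1 = 0 \<and> Option.bind (e_bar B (fst q)) (e_zero B) \<noteq> None \<and>
          f_zero C (snd q) \<noteq> None) =
       (wt B (fst p) 1 = 0 \<and> Option.bind (e_bar B (fst p)) (e_zero B) \<noteq> None \<and>
          f_zero C (snd p) \<noteq> None)"
      using n1 w[OF e] by simp_all
  qed
  show "equivariant (gl_tensor n B C) i (tensor_f_bar B C)"
    unfolding tensor_f_bar_def[abs_def]
  proof (intro equivariant_if equivariant_tensor[OF gl] comp eq)
    fix p q assume e: "e_op (gl_tensor n B C) i p = Some q"
    note n1 = none(1)[OF e comp[OF eq(3) eq(7)]] none(1)[OF e comp[OF eq(2) eq(7)]]
      none(2)[OF e eq(4)] none(2)[OF e eq(5)]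
    show "(wt B (fst q) 1 = 0 \<and> wt B (fst q) 2 = 0) = (wt B (fst p) 1 = 0 \<and> wt B (fst p) 2 = 0)"
      "(wt B (fst q) 1 = 1 \<and> Option.bind (f_zero B (fst q)) (f_bar B) \<noteq> None \<and>
          e_zero C (snd q) \<noteq> None) =
       (wt B (fst p) 1 = 1 \<and> Option.bind (f_zero B (fst p)) (f_bar B) \<noteq> None \<and>
          e_zero C (snd p) \<noteq> None)"
      "(wt B (fst q) 1 = 1 \<and> Option.bind (e_zero B (fst q)) (f_bar B) \<noteq> None \<and>
          f_zero C (snd q) \<noteq> None) =
       (wt B (fst p) 1 = 1 \<and> Option.bind (e_zero B (fst p)) (f_bar B) \<noteq> None \<and>
          f_zero C (snd p) \<noteq> None)"
      using n1 w[OF e] by simp_all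
  qed
qed

section \<open>Inverse and dichotomy axioms on the tensor product\<close>

lemma bar_wt12:
  assumes "qplus_crystal n B" "e_bar B b = Some c"
  shows "wt B c 1 = wt B b 1 + 1" and "wt B c 2 = wt B b 2 - 1"
  using bar_wt(1)[OF assms, of 1] bar_wt(1)[OF assms, of 2] by (simp_all add: std_basis_def)

lemma tensor_zero_inverse:
  assumes B: "qplus_crystal n B" and C: "qplus_crystal n C"
    and p: "p \<in> carrier B \<times> carrier C" and q: "q \<in> carrier B \<times> carrier C"
  shows "tensor_e_zero B C p = Some q \<longleftrightarrow> tensor_f_zero B C q = Some p"
proof -
  obtain b c b' c' where pq: "p = (b, c)" "q = (b', c')" by (cases p; cases q)
  show ?thesis
    using zero_preserves(1)[OF B, of b b'] zero_preserves(1)[OF B, of b' b]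
      zero_inverse[OF B, of b b'] zero_inverse[OF C, of c c']
    unfolding pq tensor_e_zero_def tensor_f_zero_def by auto
qed

text \<open>
  The two twisted branches only modify a nonzero value of the barred operator on \<open>b\<close>
  by \<open>e\<^sub>0\<close> and \<open>f\<^sub>0\<close>; they never create or destroy it.  So vanishing is decided by \<open>b\<close> alone unless
  the first two weights of \<open>b\<close> are zero, and by \<open>c\<close> alone if they are.
\<close>
lemma tensor_bar_eq_None:
  assumes B: "qplus_crystal n B"
  shows "tensor_e_bar B C (b, c) = None \<longleftrightarrow>
      (if wt B b 1 = 0 \<and> wt B b 2 = 0 then e_bar C c = None else e_bar B b = None)"
    and "tensor_f_bar B C (b, c) = None \<longleftrightarrow>
      (if wt B b 1 = 0 \<and> wt B b 2 = 0 then f_bar C c = None else f_bar B b = None)"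
proof -
  show "tensor_e_bar B C (b, c) = None \<longleftrightarrow>
      (if wt B b 1 = 0 \<and> wt B b 2 = 0 then e_bar C c = None else e_bar B b = None)"
    unfolding tensor_e_bar_def by (cases "e_bar B b") auto
  have "Option.bind (f_zero B b) (f_bar B) \<noteq> None \<Longrightarrow> f_bar B b \<noteq> None"
    using zero_preserves(5)[OF B, of b] by (cases "f_zero B b") auto
  moreover have "Option.bind (e_zero B b) (f_bar B) \<noteq> None \<Longrightarrow> f_bar B b \<noteq> None"
    using zero_preserves(5)[OF B, of b] by (cases "e_zero B b") auto
  ultimately show "tensor_f_bar B C (b, c) = None \<longleftrightarrow>
      (if wt B b 1 = 0 \<and> wt B b 2 = 0 then f_bar C c = None else f_bar B b = None)"
    unfolding tensor_f_bar_def by auto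
qed

lemma tensor_e_bar_Some:
  assumes "tensor_e_bar B C (b, c) = Some (b', c')"
  obtains (inner) "wt B b 1 = 0" "wt B b 2 = 0" "b' = b" "e_bar C c = Some c'"
    | (twist_f) x where "wt B b 1 = 0" "e_bar B b = Some x" "f_zero B x = Some b'"
        "e_zero C c = Some c'"
    | (twist_e) x where "wt B b 1 = 0" "e_bar B b = Some x" "e_zero B x = Some b'"
        "f_zero C c = Some c'"
    | (outer) "e_bar B b = Some b'" "c' = c"
        "wt B b 1 = 0 \<Longrightarrow> f_zero B b' = None \<or> e_zero C c = None"
        "wt B b 1 = 0 \<Longrightarrow> e_zero B b' = None \<or> f_zero C c = None"
  using assms unfolding tensor_e_bar_def by (auto split: if_splits simp: bind_eq_Some_conv)

lemma tensor_f_bar_Some: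
  assumes "tensor_f_bar B C (b, c) = Some (b', c')"
  obtains (inner) "wt B b 1 = 0" "wt B b 2 = 0" "b' = b" "f_bar C c = Some c'"
    | (twist_f) x where "wt B b 1 = 1" "f_zero B b = Some x" "f_bar B x = Some b'"
        "e_zero C c = Some c'"
    | (twist_e) x where "wt B b 1 = 1" "e_zero B b = Some x" "f_bar B x = Some b'"
        "f_zero C c = Some c'"
    | (outer) "f_bar B b = Some b'" "c' = c"
        "wt B b 1 = 1 \<Longrightarrow> Option.bind (f_zero B b) (f_bar B) = None \<or> e_zero C c = None"
        "wt B b 1 = 1 \<Longrightarrow> Option.bind (e_zero B b) (f_bar B) = None \<or> f_zero C c = None"
proof -
  let ?wt0 = "wt B b 1 = 0 \<and> wt B b 2 = 0"
  let ?f = "wt B b 1 = 1 \<and> Option.bind (f_zero B b) (f_bar B) \<noteq> None \<and> e_zero C c \<noteq> None"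
  let ?e = "wt B b 1 = 1 \<and> Option.bind (e_zero B b) (f_bar B) \<noteq> None \<and> f_zero C c \<noteq> None"
  note eq = assms[unfolded tensor_f_bar_def fst_conv snd_conv]
  consider (1) ?wt0 | (2) "\<not> ?wt0" ?f | (3) "\<not> ?wt0" "\<not> ?f" ?e | (4) "\<not> ?wt0" "\<not> ?f" "\<not> ?e"
    by blast
  then show thesis
  proof cases
    case 1
    from eq[unfolded if_P[OF 1]] 1 show thesis by (intro inner) auto
  next
    case 2
    from eq[unfolded if_not_P[OF 2(1)] if_P[OF 2(2)]] 2(2) show thesis
      by (auto simp: bind_eq_Some_conv intro: twist_f)
  next
    case 3
    from eq[unfolded if_not_P[OF 3(1)] if_not_P[OF 3(2)] if_P[OF 3(3)]] 3(3) show thesis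
      by (auto simp: bind_eq_Some_conv intro: twist_e)
  next
    case 4
    have "f_bar B b = Some b'" "c' = c"
      using eq[unfolded if_not_P[OF 4(1)] if_not_P[OF 4(2)] if_not_P[OF 4(3)]] by auto
    then show thesis using outer 4(2,3) by blast
  qed
qed

lemma not_both_zero:
  assumes "qplus_crystal n B"
  shows "e_zero B b = Some x \<Longrightarrow> f_zero B b = None" "f_zero B b = Some x \<Longrightarrow> e_zero B b = None"
  using zero_exactly_one[OF assms, of b] zero_carrier[OF assms, of b x] by (metis not_None_eq)+

text \<open>
  The raising operator leaves weight \<open>wt(b)\<^sub>1 = 0\<close> for \<open>wt(b')\<^sub>1 = 1\<close>, which is exactly where the
  lowering formula looks for twists.  A twist by \<open>f\<^sub>0\<close> on the left and \<open>e\<^sub>0\<close> on the right is undone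
  by a twist by \<open>e\<^sub>0\<close> and \<open>f\<^sub>0\<close>, so the second and third branches of the two formulas are
  exchanged; the fact that \<open>e\<^sub>0\<close> and \<open>f\<^sub>0\<close> never both act on one element shows that the intended
  branch is the one selected.
\<close>
lemma tensor_bar_inverse:
  assumes B: "qplus_crystal n B" and C: "qplus_crystal n C"
    and p: "p \<in> carrier B \<times> carrier C" and q: "q \<in> carrier B \<times> carrier C"
  shows "tensor_e_bar B C p = Some q \<longleftrightarrow> tensor_f_bar B C q = Some p"
proof -
  obtain b c b' c' where pq: "p = (b, c)" "q = (b', c')" by (cases p; cases q)
  note zi = zero_inverse[OF B] zero_inverse[OF C] and bi = bar_inverse[OF B] bar_inverse[OF C]
  note nb = not_both_zero[OF B] not_both_zero[OF C]
  note w = bar_wt12[OF B] and nn = qplus_wt_nonneg[OF B] and zw = zero_preserves[OF B]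
  show ?thesis
  proof
    assume "tensor_e_bar B C p = Some q"
    then have "tensor_e_bar B C (b, c) = Some (b', c')" by (simp only: pq)
    then show "tensor_f_bar B C q = Some p"
    proof (cases rule: tensor_e_bar_Some)
      case inner
      then show ?thesis by (simp add: pq tensor_f_bar_def bi)
    next
      case (twist_f x)
      have "wt B b' 1 = 1" using w(1)[OF twist_f(2)] zw(1)[of x b'] twist_f by simp
      moreover have "e_zero B b' = Some x" "f_zero C c' = Some c" using twist_f zi by auto
      moreover have "f_zero B b' = None" "f_bar B x = Some b" using calculation nb bi twist_f by auto
      ultimately show ?thesis by (simp add: pq tensor_f_bar_def)
    next
      case (twist_e x)
      have "wt B b' 1 = 1" using w(1)[OF twist_e(2)] zw(1)[of x b'] twist_e by simp
      moreover have "f_zero B b' = Some x" "e_zero C c' = Some c" using twist_e zi by auto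
      moreover have "f_bar B x = Some b" using bi twist_e by auto
      ultimately show ?thesis by (simp add: pq tensor_f_bar_def)
    next
      case outer
      have "f_bar B b' = Some b" using outer bi by auto
      moreover have "wt B b' 1 = wt B b 1 + 1" by (rule w(1)[OF outer(1)])
      moreover have "0 \<le> wt B b 1" using nn p pq by auto
      ultimately show ?thesis using outer(2,3,4)
        by (cases "f_zero B b' = None"; cases "e_zero B b' = None") (auto simp: pq tensor_f_bar_def)
    qed
  next
    assume "tensor_f_bar B C q = Some p"
    then have "tensor_f_bar B C (b', c') = Some (b, c)" by (simp only: pq)
    then show "tensor_e_bar B C p = Some q"
    proof (cases rule: tensor_f_bar_Some)
      case inner
      then show ?thesis by (simp add: pq tensor_e_bar_def bi)
    next
      case (twist_f x)
      have e: "e_bar B b = Some x" using twist_f bi by auto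
      have x: "wt B x = wt B b'" using zw(1)[of b' x] twist_f by simp
      have "wt B b 1 = 0" "wt B b 2 \<noteq> 0"
        using w[OF e] twist_f x nn[of x 2] bar_carrier[OF B, of b x] e by auto
      moreover have "e_zero B x = Some b'" "f_zero C c = Some c'" using twist_f zi by auto
      moreover have "f_zero B x = None" using calculation nb by auto
      ultimately show ?thesis using e by (simp add: pq tensor_e_bar_def)
    next
      case (twist_e x)
      have e: "e_bar B b = Some x" using twist_e bi by auto
      have x: "wt B x = wt B b'" using zw(1)[of b' x] twist_e by simp
      have "wt B b 1 = 0" "wt B b 2 \<noteq> 0"
        using w[OF e] twist_e x nn[of x 2] bar_carrier[OF B, of b x] e by auto
      moreover have "f_zero B x = Some b'" "e_zero C c = Some c'" using twist_e zi by auto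
      ultimately show ?thesis using e by (simp add: pq tensor_e_bar_def)
    next
      case outer
      have e: "e_bar B b = Some b'" using outer bi by auto
      have "wt B b 2 \<noteq> 0" using w(2)[OF e] nn[of b' 2] q pq by auto
      moreover have "f_zero B b' = None \<or> e_zero C c' = None"
        "e_zero B b' = None \<or> f_zero C c' = None" if "wt B b 1 = 0"
      proof -
        have "Option.bind (g b') (f_bar B) \<noteq> None"
          if "g = e_zero B \<or> g = f_zero B" "g b' \<noteq> None" for g
          using that zw(5)[of b'] outer(1) by (cases "g b'") auto
        then show "f_zero B b' = None \<or> e_zero C c' = None"
          "e_zero B b' = None \<or> f_zero C c' = None"
          using outer(3,4) w(1)[OF e] \<open>wt B b 1 = 0\<close> by fastforce+
      qed
      ultimately show ?thesis using e outer(2)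
        by (cases "wt B b 1 = 0") (auto simp: pq tensor_e_bar_def)
    qed
  qed
qed

lemma tensor_zero_exactly_one:
  assumes B: "qplus_crystal n B" and C: "qplus_crystal n C"
    and b: "b \<in> carrier B" and c: "c \<in> carrier C"
  shows "if wt B b 1 + wt C c 1 = 0
    then tensor_e_zero B C (b, c) = None \<and> tensor_f_zero B C (b, c) = None
    else (tensor_e_zero B C (b, c) = None) \<noteq> (tensor_f_zero B C (b, c) = None)"
  using zero_exactly_one[OF B b] zero_exactly_one[OF C c]
    qplus_wt_nonneg[OF B b, of 1] qplus_wt_nonneg[OF C c, of 1]
  by (auto simp: tensor_e_zero_def tensor_f_zero_def)

text \<open>
  Axiom (P3), read off from the vanishing criterion \<open>tensor_bar_eq_None\<close>: in each case the
  alternative is the one that already holds in a single factor.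
\<close>
lemma tensor_bar_exactly_one:
  assumes B: "qplus_crystal n B" and C: "qplus_crystal n C" and n: "2 \<le> n"
    and b: "b \<in> carrier B" and c: "c \<in> carrier C"
  shows "if wt B b 1 + wt C c 1 = 0 \<and> wt B b 2 + wt C c 2 = 0
    then tensor_e_bar B C (b, c) = None \<and> tensor_f_bar B C (b, c) = None
    else (tensor_e_bar B C (b, c) = None) \<noteq> (tensor_f_bar B C (b, c) = None)"
  using bar_exactly_one[OF B b n] bar_exactly_one[OF C c n]
    qplus_wt_nonneg[OF B b, of 1] qplus_wt_nonneg[OF C c, of 1]
    qplus_wt_nonneg[OF B b, of 2] qplus_wt_nonneg[OF C c, of 2]
  unfolding tensor_bar_eq_None[OF B] by auto

section \<open>Existence and uniqueness\<close>

lemma tensor_zero_carrier: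
  assumes B: "qplus_crystal n B" and C: "qplus_crystal n C" and p: "p \<in> carrier B \<times> carrier C"
  shows "tensor_e_zero B C p = Some q \<Longrightarrow> q \<in> carrier B \<times> carrier C"
    and "tensor_f_zero B C p = Some q \<Longrightarrow> q \<in> carrier B \<times> carrier C"
  using string_preservingD(1)[OF tensor_zero_string_preserving(1)[OF B C], of p q]
    string_preservingD(1)[OF tensor_zero_string_preserving(2)[OF B C], of p q] p by simp_all

lemma tensor_bar_carrier:
  assumes B: "qplus_crystal n B" and C: "qplus_crystal n C" and p: "p \<in> carrier B \<times> carrier C"
  shows "tensor_e_bar B C p = Some q \<Longrightarrow> q \<in> carrier B \<times> carrier C"
    and "tensor_f_bar B C p = Some q \<Longrightarrow> q \<in> carrier B \<times> carrier C"
  using string_preservingD(1)[OF equivariantD(1)[OF tensor_bar_equivariant(1)[OF B C order_refl]],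
      of p q]
    string_preservingD(1)[OF equivariantD(1)[OF tensor_bar_equivariant(2)[OF B C order_refl]],
      of p q] p
  by simp_all

lemma tensor_e_zero_wt:
  assumes B: "qplus_crystal n B" and C: "qplus_crystal n C"
    and "tensor_e_zero B C p = Some q"
  shows "wt (gl_tensor n B C) q = wt (gl_tensor n B C) p"
  using assms(3) zero_preserves(1)[OF B, of "fst p" "fst q"] zero_preserves(1)[OF C, of "snd p" "snd q"]
  by (cases p; cases q) (auto simp: tensor_e_zero_def gl_tensor_def split: if_splits)

lemma tensor_e_bar_wt:
  assumes B: "qplus_crystal n B" and C: "qplus_crystal n C"
    and "tensor_e_bar B C p = Some q"
  shows "wt (gl_tensor n B C) q j - wt (gl_tensor n B C) p j = std_basis 1 j - std_basis 2 j"
proof -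
  obtain b c b' c' where pq: "p = (b, c)" "q = (b', c')" by (cases p; cases q)
  have "tensor_e_bar B C (b, c) = Some (b', c')" using assms(3) by (simp only: pq)
  then have "wt B b' j + wt C c' j = wt B b j + wt C c j + (std_basis 1 j - std_basis 2 j)"
  proof (cases rule: tensor_e_bar_Some)
    case inner
    then show ?thesis using bar_wt(1)[OF C inner(4)] by simp
  next
    case (twist_f x)
    then show ?thesis using bar_wt(1)[OF B twist_f(2)]
        zero_preserves(1)[OF B, of x b'] zero_preserves(1)[OF C, of c c'] by simp
  next
    case (twist_e x)
    then show ?thesis using bar_wt(1)[OF B twist_e(2)]
        zero_preserves(1)[OF B, of x b'] zero_preserves(1)[OF C, of c c'] by simp
  next
    case outer
    then show ?thesis using bar_wt(1)[OF B outer(1)] by simp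
  qed
  then show ?thesis by (simp add: pq)
qed

text \<open>
  Since \<open>e\<^sub>0\<close> changes one factor, within which it preserves weights and the vanishing of the barred
  operators, the criterion \<open>tensor_bar_eq_None\<close> has the same value before and after.
\<close>
lemma tensor_e_zero_preserves_bar_None:
  assumes B: "qplus_crystal n B" and C: "qplus_crystal n C"
    and "tensor_e_zero B C p = Some q"
  shows "tensor_e_bar B C q = None \<longleftrightarrow> tensor_e_bar B C p = None"
    and "tensor_f_bar B C q = None \<longleftrightarrow> tensor_f_bar B C p = None"
proof -
  obtain b c b' c' where pq: "p = (b, c)" "q = (b', c')" by (cases p; cases q)
  show "tensor_e_bar B C q = None \<longleftrightarrow> tensor_e_bar B C p = None"
    and "tensor_f_bar B C q = None \<longleftrightarrow> tensor_f_bar B C p = None"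
    using assms(3) zero_preserves(1,4,5)[OF B, of b b'] zero_preserves(1,4,5)[OF C, of c c']
    unfolding pq tensor_bar_eq_None[OF B] tensor_e_zero_def
    by (simp_all split: if_splits)
qed

lemma gl_crystal_tensor_structure:
  assumes "gl_crystal n B" "gl_crystal n C"
  shows "gl_crystal n (tensor_structure n B C)"
  using gl_crystal_gl_tensor[OF assms] unfolding gl_crystal_def by simp

lemma tensor_structure_string_len:
  assumes "gl_crystal n B" "gl_crystal n C" "string_preserving (gl_tensor n B C) i u"
    and "p \<in> carrier B \<times> carrier C" "u p = Some q"
  shows "string_len (e_op (tensor_structure n B C) i) p = string_len (e_op (tensor_structure n B C) i) q"
    and "string_len (f_op (tensor_structure n B C) i) p = string_len (f_op (tensor_structure n B C) i) q"
  using string_preservingD(2,3)[OF assms(3) _ assms(5)] assms(4)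
    gl_string_len[OF gl_crystal_gl_tensor[OF assms(1,2)]] by simp_all

lemma tensor_structure_ops_commute:
  assumes "gl_crystal n B" "gl_crystal n C" "equivariant (gl_tensor n B C) i u"
    and "\<And>p. p \<in> carrier B \<times> carrier C \<Longrightarrow> v p = u p"
  shows "ops_commute (carrier B \<times> carrier C) (e_op (gl_tensor n B C) i) v"
    and "ops_commute (carrier B \<times> carrier C) (f_op (gl_tensor n B C) i) v"
proof -
  note gl = gl_crystal_gl_tensor[OF assms(1,2)]
  have "equivariant (gl_tensor n B C) i v"
    by (rule equivariant_cong[OF gl assms(3)]) (use assms(4) in simp)
  from equivariant_imp_ops_commute[OF gl this]
  show "ops_commute (carrier B \<times> carrier C) (e_op (gl_tensor n B C) i) v"
    and "ops_commute (carrier B \<times> carrier C) (f_op (gl_tensor n B C) i) v" by simp_all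
qed

lemma tensor_structure_op_carrier:
  assumes B: "qplus_crystal n B" and C: "qplus_crystal n C"
  shows "e_zero (tensor_structure n B C) p = Some q \<Longrightarrow>
      p \<in> carrier B \<times> carrier C \<and> q \<in> carrier B \<times> carrier C"
    and "f_zero (tensor_structure n B C) p = Some q \<Longrightarrow>
      p \<in> carrier B \<times> carrier C \<and> q \<in> carrier B \<times> carrier C"
    and "e_bar (tensor_structure n B C) p = Some q \<Longrightarrow>
      2 \<le> n \<and> p \<in> carrier B \<times> carrier C \<and> q \<in> carrier B \<times> carrier C"
    and "f_bar (tensor_structure n B C) p = Some q \<Longrightarrow>
      2 \<le> n \<and> p \<in> carrier B \<times> carrier C \<and> q \<in> carrier B \<times> carrier C"
  using tensor_zero_carrier[OF B C, of p q] tensor_bar_carrier[OF B C, of p q]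
  by (simp_all split: if_splits)

lemma tensor_structure_inverse:
  assumes B: "qplus_crystal n B" and C: "qplus_crystal n C"
  defines "X \<equiv> tensor_structure n B C"
  shows "e_zero X p = Some q \<longleftrightarrow> f_zero X q = Some p"
    and "e_bar X p = Some q \<longleftrightarrow> f_bar X q = Some p"
proof -
  note op = tensor_structure_op_carrier[OF B C]
  have on: "e_zero X p = Some q \<longleftrightarrow> f_zero X q = Some p"
    "e_bar X p = Some q \<longleftrightarrow> f_bar X q = Some p"
    if "p \<in> carrier B \<times> carrier C" "q \<in> carrier B \<times> carrier C"
    using that tensor_zero_inverse[OF B C that] tensor_bar_inverse[OF B C that]
    by (simp_all add: X_def)
  show "e_zero X p = Some q \<longleftrightarrow> f_zero X q = Some p"
    using on(1) op(1)[of p q] op(2)[of q p] unfolding X_def by blast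
  show "e_bar X p = Some q \<longleftrightarrow> f_bar X q = Some p"
    using on(2) op(3)[of p q] op(4)[of q p] unfolding X_def by blast
qed

lemma tensor_structure_bar_sum:
  assumes B: "qplus_crystal n B" and C: "qplus_crystal n C" and n: "2 \<le> n"
    and p: "p \<in> carrier B \<times> carrier C"
  defines "X \<equiv> tensor_structure n B C"
  shows "string_len (e_bar X) p + string_len (f_bar X) p =
    (if wt X p 1 = 0 \<and> wt X p 2 = 0 then 0 else 1)"
proof -
  note inv = tensor_structure_inverse(2)[OF B C, folded X_def]
  have on: "p \<in> carrier X \<and> q \<in> carrier X" if "e_bar X p = Some q" for p q
    using tensor_structure_op_carrier(3)[OF B C that[unfolded X_def]] by (simp add: X_def)
  let ?one = "\<lambda>p. if wt X p 1 = 0 \<and> wt X p 2 = 0 then e_bar X p = None \<and> f_bar X p = None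
      else (e_bar X p = None) \<noteq> (f_bar X p = None)"
  have "\<forall>p\<in>carrier X. ?one p"
  proof
    fix p assume "p \<in> carrier X"
    then obtain b c where p: "p = (b, c)" "b \<in> carrier B" "c \<in> carrier C"
      by (cases p) (simp add: X_def)
    show "?one p" using tensor_bar_exactly_one[OF B C n p(2,3)] p by (simp add: X_def n)
  qed
  then have "\<forall>p\<in>carrier X. string_len (e_bar X) p + string_len (f_bar X) p =
      (if wt X p 1 = 0 \<and> wt X p 2 = 0 then 0 else 1)"
    using string_len_sum_iff[of "e_bar X" "f_bar X" "carrier X" "\<lambda>p. wt X p 1 = 0 \<and> wt X p 2 = 0", OF inv on]
    by blast
  moreover have "p \<in> carrier X" using p by (simp add: X_def)
  ultimately show ?thesis by blast
qed

lemma tensor_structure_zero_sum: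
  assumes B: "qplus_crystal n B" and C: "qplus_crystal n C"
    and p: "p \<in> carrier B \<times> carrier C"
  defines "X \<equiv> tensor_structure n B C"
  shows "string_len (e_zero X) p + string_len (f_zero X) p = (if wt X p 1 = 0 then 0 else 1)"
proof -
  note inv = tensor_structure_inverse(1)[OF B C, folded X_def]
  have on: "p \<in> carrier X \<and> q \<in> carrier X" if "e_zero X p = Some q" for p q
    using tensor_structure_op_carrier(1)[OF B C that[unfolded X_def]] by (simp add: X_def)
  let ?one = "\<lambda>p. if wt X p 1 = 0 then e_zero X p = None \<and> f_zero X p = None
      else (e_zero X p = None) \<noteq> (f_zero X p = None)"
  have "\<forall>p\<in>carrier X. ?one p"
  proof
    fix p assume "p \<in> carrier X"
    then obtain b c where p: "p = (b, c)" "b \<in> carrier B" "c \<in> carrier C"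
      by (cases p) (simp add: X_def)
    show "?one p" using tensor_zero_exactly_one[OF B C p(2,3)] p by (simp add: X_def)
  qed
  then have "\<forall>p\<in>carrier X. string_len (e_zero X) p + string_len (f_zero X) p =
      (if wt X p 1 = 0 then 0 else 1)"
    using string_len_sum_iff[of "e_zero X" "f_zero X" "carrier X" "\<lambda>p. wt X p 1 = 0", OF inv on]
    by blast
  moreover have "p \<in> carrier X" using p by (simp add: X_def)
  ultimately show ?thesis by blast
qed

lemma q_crystal_tensor_structure:
  assumes B: "qplus_crystal n B" and C: "qplus_crystal n C"
  shows "q_crystal n (tensor_structure n B C)"
proof -
  let ?X = "tensor_structure n B C"
  note gl = qplus_gl[OF B] qplus_gl[OF C]
  have wt: "0 \<le> wt ?X p j" if "p \<in> carrier ?X" for p j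
    using that qplus_wt_nonneg[OF B, of "fst p" j] qplus_wt_nonneg[OF C, of "snd p" j]
    by (cases p) auto
  have on: "operator_on (carrier ?X) (e_bar ?X)" "operator_on (carrier ?X) (f_bar ?X)"
    using tensor_structure_op_carrier(3,4)[OF B C] unfolding operator_on_def tensor_structure_simps(1)
    by (metis not_None_eq)+
  have inv: "e_bar ?X p = Some q \<longleftrightarrow> f_bar ?X q = Some p" for p q
    by (rule tensor_structure_inverse(2)[OF B C])
  have e: "(\<forall>j. wt ?X q j - wt ?X p j = std_basis 1 j - std_basis 2 j) \<and>
      (\<forall>i\<in>{3..<n}. string_len (e_op ?X i) p = string_len (e_op ?X i) q \<and>
                   string_len (f_op ?X i) p = string_len (f_op ?X i) q)"
    if pq: "p \<in> carrier ?X" "e_bar ?X p = Some q" for p q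
  proof -
    have pq': "p \<in> carrier B \<times> carrier C" "tensor_e_bar B C p = Some q"
      using pq by (simp_all split: if_splits)
    show ?thesis
      using tensor_e_bar_wt[OF B C pq'(2)] tensor_structure_string_len[OF gl
        equivariantD(1)[OF tensor_bar_equivariant(1)[OF B C]] pq'] by simp
  qed
  have comm: "ops_commute (carrier ?X) (e_op ?X i) (e_bar ?X) \<and>
      ops_commute (carrier ?X) (e_op ?X i) (f_bar ?X) \<and>
      ops_commute (carrier ?X) (f_op ?X i) (e_bar ?X) \<and>
      ops_commute (carrier ?X) (f_op ?X i) (f_bar ?X)" if "2 \<le> n" "3 \<le> i" for i
    using tensor_structure_ops_commute[OF gl tensor_bar_equivariant(1)[OF B C that(2)], of "e_bar ?X"]
      tensor_structure_ops_commute[OF gl tensor_bar_equivariant(2)[OF B C that(2)], of "f_bar ?X"]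
    by (simp add: that(1))
  have bars: "2 \<le> n \<longrightarrow>
       operator_on (carrier ?X) (e_bar ?X) \<and> operator_on (carrier ?X) (f_bar ?X) \<and>
       (\<forall>b\<in>carrier ?X. \<forall>c\<in>carrier ?X.
          (e_bar ?X b = Some c \<longleftrightarrow> f_bar ?X c = Some b) \<and>
          (e_bar ?X b = Some c \<longrightarrow>
             (\<forall>j. wt ?X c j - wt ?X b j = std_basis 1 j - std_basis 2 j) \<and>
             (\<forall>i\<in>{3..<n}. string_len (e_op ?X i) b = string_len (e_op ?X i) c \<and>
                          string_len (f_op ?X i) b = string_len (f_op ?X i) c))) \<and>
       (\<forall>i\<in>{3..<n}.
          ops_commute (carrier ?X) (e_op ?X i) (e_bar ?X) \<and>
          ops_commute (carrier ?X) (e_op ?X i) (f_bar ?X) \<and>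
          ops_commute (carrier ?X) (f_op ?X i) (e_bar ?X) \<and>
          ops_commute (carrier ?X) (f_op ?X i) (f_bar ?X)) \<and>
       (\<forall>b\<in>carrier ?X. string_len (e_bar ?X) b + string_len (f_bar ?X) b =
          (if wt ?X b 1 = 0 \<and> wt ?X b 2 = 0 then 0 else 1))"
  proof (intro impI conjI ballI)
    fix p assume "2 \<le> n" "p \<in> carrier ?X"
    then show "string_len (e_bar ?X) p + string_len (f_bar ?X) p =
          (if wt ?X p 1 = 0 \<and> wt ?X p 2 = 0 then 0 else 1)"
      using tensor_structure_bar_sum[OF B C] by simp
  qed (use on inv e comm in \<open>(blast | meson atLeastLessThan_iff)+\<close>)
  show ?thesis
    unfolding q_crystal_def
  proof (intro conjI)
    show "gl_crystal n ?X" by (rule gl_crystal_tensor_structure[OF gl])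
    show "\<forall>p\<in>carrier ?X. \<forall>j. 0 \<le> wt ?X p j" using wt by blast
    show "n < 2 \<longrightarrow> (\<forall>p. e_bar ?X p = None \<and> f_bar ?X p = None)" by simp
  qed (rule bars)
qed

theorem qplus_crystal_tensor_structure:
  assumes B: "qplus_crystal n B" and C: "qplus_crystal n C"
  shows "qplus_crystal n (tensor_structure n B C)"
proof -
  let ?X = "tensor_structure n B C"
  note gl = qplus_gl[OF B] qplus_gl[OF C]
  have on: "operator_on (carrier ?X) (e_zero ?X)" "operator_on (carrier ?X) (f_zero ?X)"
    using tensor_structure_op_carrier(1,2)[OF B C] unfolding operator_on_def tensor_structure_simps(1)
    by (metis not_None_eq)+
  have preserved: "wt ?X p = wt ?X q \<and>
      (\<forall>i\<in>{1..<n}. string_len (e_op ?X i) p = string_len (e_op ?X i) q \<and>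
                   string_len (f_op ?X i) p = string_len (f_op ?X i) q) \<and>
      (2 \<le> n \<longrightarrow> string_len (e_bar ?X) p = string_len (e_bar ?X) q \<and>
                string_len (f_bar ?X) p = string_len (f_bar ?X) q)"
    if pq: "p \<in> carrier ?X" "q \<in> carrier ?X" "e_zero ?X p = Some q" for p q
  proof -
    have pq': "p \<in> carrier B \<times> carrier C" "q \<in> carrier B \<times> carrier C"
        "tensor_e_zero B C p = Some q"
      using pq by (simp_all split: if_splits)
    have "string_len (e_bar ?X) p = string_len (e_bar ?X) q \<and>
          string_len (f_bar ?X) p = string_len (f_bar ?X) q" if n: "2 \<le> n"
    proof -
      have "e_bar ?X q = None \<longleftrightarrow> e_bar ?X p = None" "f_bar ?X q = None \<longleftrightarrow> f_bar ?X p = None"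
        using tensor_e_zero_preserves_bar_None[OF B C pq'(3)] pq'(1,2) n
        by (simp_all only: tensor_structure_simps simp_thms if_True)
      then show ?thesis
        using string_len_toggle[OF tensor_structure_bar_sum[OF B C n pq'(1)]]
          string_len_toggle[OF tensor_structure_bar_sum[OF B C n pq'(2)]] by presburger
    qed
    then show ?thesis
      using tensor_e_zero_wt[OF B C pq'(3)] tensor_structure_string_len[OF gl
        tensor_zero_string_preserving(1)[OF B C] pq'(1,3)] by simp
  qed
  have comm: "ops_commute (carrier ?X) (e_op ?X i) (e_zero ?X) \<and>
      ops_commute (carrier ?X) (e_op ?X i) (f_zero ?X) \<and>
      ops_commute (carrier ?X) (f_op ?X i) (e_zero ?X) \<and>
      ops_commute (carrier ?X) (f_op ?X i) (f_zero ?X)" if "2 \<le> i" for i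
    using tensor_structure_ops_commute[OF gl tensor_zero_equivariant(1)[OF B C that], of "e_zero ?X"]
      tensor_structure_ops_commute[OF gl tensor_zero_equivariant(2)[OF B C that], of "f_zero ?X"]
    by simp
  show ?thesis
    unfolding qplus_crystal_def
  proof (intro conjI)
    show "q_crystal n ?X" by (rule q_crystal_tensor_structure[OF B C])
    show "\<forall>p\<in>carrier ?X. \<forall>q\<in>carrier ?X. (e_zero ?X p = Some q \<longleftrightarrow> f_zero ?X q = Some p) \<and>
        (e_zero ?X p = Some q \<longrightarrow> wt ?X p = wt ?X q \<and>
          (\<forall>i\<in>{1..<n}. string_len (e_op ?X i) p = string_len (e_op ?X i) q \<and>
                       string_len (f_op ?X i) p = string_len (f_op ?X i) q) \<and>
          (2 \<le> n \<longrightarrow> string_len (e_bar ?X) p = string_len (e_bar ?X) q \<and>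
                    string_len (f_bar ?X) p = string_len (f_bar ?X) q))"
      using preserved tensor_structure_inverse(1)[OF B C] by blast
    show "\<forall>i\<in>{2..<n}. ops_commute (carrier ?X) (e_op ?X i) (e_zero ?X) \<and>
        ops_commute (carrier ?X) (e_op ?X i) (f_zero ?X) \<and>
        ops_commute (carrier ?X) (f_op ?X i) (e_zero ?X) \<and>
        ops_commute (carrier ?X) (f_op ?X i) (f_zero ?X)"
      using comm by (meson atLeastLessThan_iff)
    show "\<forall>p\<in>carrier ?X. string_len (e_zero ?X) p + string_len (f_zero ?X) p =
        (if wt ?X p 1 = 0 then 0 else 1)"
      using tensor_structure_zero_sum[OF B C] by (simp only: tensor_structure_simps(1)) blast
  qed (rule on)+
qed

lemma is_qplus_tensor_tensor_structure:
  assumes B: "qplus_crystal n B" and C: "qplus_crystal n C"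
  shows "is_qplus_tensor n B C (tensor_structure n B C)"
proof -
  have "gl_data.truncate (tensor_structure n B C) = gl_tensor n B C"
    by (simp add: gl_data.truncate_def)
  then show ?thesis
    unfolding is_qplus_tensor_def
    using qplus_crystal_tensor_structure[OF B C]
    by (intro conjI ballI impI)
      (simp_all only: tensor_structure_simps mem_Sigma_iff simp_thms if_True fst_conv snd_conv
        tensor_e_zero_def tensor_f_zero_def tensor_e_bar_def tensor_f_bar_def)
qed

text \<open>
  All operators are prescribed on the carrier, and the normalisation fixes them off the carrier and
  for \<open>n < 2\<close>.
\<close>
lemma is_qplus_tensor_unique:
  assumes X: "is_qplus_tensor n B C X" and Y: "is_qplus_tensor n B C Y"
  shows "X = Y"
proof -
  have tr: "gl_data.truncate X = gl_tensor n B C" "gl_data.truncate Y = gl_tensor n B C"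
    using X Y by (simp_all add: is_qplus_tensor_def)
  then have gl: "carrier X = carrier Y" "wt X = wt Y" "e_op X = e_op Y" "f_op X = f_op Y"
    by (metis gl_data.truncate_def gl_data.ext_inject)+
  have car: "carrier X = carrier B \<times> carrier C"
    using tr(1) by (metis gl_data.select_convs(1) gl_data.truncate_def gl_tensor_carrier)
  have qX: "qplus_crystal n X" and qY: "qplus_crystal n Y"
    using X Y by (simp_all add: is_qplus_tensor_def)
  have zero: "e_zero X p = e_zero Y p \<and> f_zero X p = f_zero Y p" for p
  proof (cases "p \<in> carrier X")
    case True
    then obtain b c where "p = (b, c)" "b \<in> carrier B" "c \<in> carrier C" using car by auto
    then show ?thesis using X Y unfolding is_qplus_tensor_def by simp
  next
    case False
    then show ?thesis using zero_carrier[OF qX, of p] zero_carrier[OF qY, of p] gl(1)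
      by (metis not_None_eq)
  qed
  have bar: "e_bar X p = e_bar Y p \<and> f_bar X p = f_bar Y p" for p
  proof (cases "p \<in> carrier X \<and> 2 \<le> n")
    case True
    then obtain b c where "p = (b, c)" "b \<in> carrier B" "c \<in> carrier C" using car by auto
    then show ?thesis using X Y True unfolding is_qplus_tensor_def by (metis (no_types, lifting))
  next
    case False
    then show ?thesis using bar_carrier[OF qX, of p] bar_carrier[OF qY, of p] gl(1)
      by (metis not_None_eq)
  qed
  from zero bar have "e_zero X = e_zero Y" "f_zero X = f_zero Y" "e_bar X = e_bar Y" "f_bar X = f_bar Y"
    by (simp_all add: fun_eq_iff)
  with gl show ?thesis by (intro qplus_data.equality) simp_all
qed

lemma qplus_tensor_eq:
  assumes "qplus_crystal n B" "qplus_crystal n C"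
  shows "qplus_tensor n B C = tensor_structure n B C"
  unfolding qplus_tensor_def
proof (rule the_equality)
  show *: "is_qplus_tensor n B C (tensor_structure n B C)"
    by (rule is_qplus_tensor_tensor_structure[OF assms])
  show "X = tensor_structure n B C" if "is_qplus_tensor n B C X" for X
    by (rule is_qplus_tensor_unique[OF that *])
qed

section \<open>Associativity\<close>

abbreviation (input) reassoc :: "('b \<times> 'c) \<times> 'd \<Rightarrow> 'b \<times> ('c \<times> 'd)" where
  "reassoc \<equiv> \<lambda>((b, c), d). (b, (c, d))"

lemma gl_tensor_tensor_structure [simp]:
  "gl_tensor n B (tensor_structure n C D) = gl_tensor n B (gl_tensor n C D)"
  "gl_tensor n (tensor_structure n C D) E = gl_tensor n (gl_tensor n C D) E"
  by (simp_all only: gl_tensor_def[of n B] gl_tensor_def[of n _ E] tensor_structure_simps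
      gl_tensor_carrier cong: if_cong)

text \<open>
  With the formulas for \<open>\<epsilon>\<^sub>i\<close> and \<open>\<phi>\<^sub>i\<close> of a tensor product, both bracketings choose the factor on
  which \<open>f\<^sub>i\<close> acts by equivalent linear inequalities.
\<close>
lemma gl_tensor_assoc:
  assumes B: "gl_crystal n B" and C: "gl_crystal n C" and D: "gl_crystal n D"
    and b: "b \<in> carrier B" and c: "c \<in> carrier C" and d: "d \<in> carrier D"
  shows "f_op (gl_tensor n B (gl_tensor n C D)) i (b, (c, d)) =
    map_option reassoc (f_op (gl_tensor n (gl_tensor n B C) D) i ((b, c), d))"
proof -
  note BC = gl_crystal_gl_tensor[OF B C] and CD = gl_crystal_gl_tensor[OF C D]
  have bc: "(b, c) \<in> carrier (gl_tensor n B C)" and cd: "(c, d) \<in> carrier (gl_tensor n C D)"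
    using b c d by simp_all
  show ?thesis
    unfolding gl_tensor_op(2)[OF BC D bc d] gl_tensor_op(2)[OF B CD b cd]
      gl_tensor_eps_phi[OF B C b c] gl_tensor_eps_phi[OF C D c d]
      gl_tensor_op(2)[OF B C b c] gl_tensor_op(2)[OF C D c d]
    by (cases "f_op B i b"; cases "f_op C i c"; cases "f_op D i d") auto
qed

lemma tensor_zero_assoc:
  assumes B: "qplus_crystal n B" and C: "qplus_crystal n C"
    and b: "b \<in> carrier B" and c: "c \<in> carrier C" and d: "d \<in> carrier D"
  shows "f_zero (tensor_structure n B (tensor_structure n C D)) (b, (c, d)) =
    map_option reassoc (f_zero (tensor_structure n (tensor_structure n B C) D) ((b, c), d))"
  using qplus_wt_nonneg[OF B b, of 1] qplus_wt_nonneg[OF C c, of 1] zero_exactly_one(2)[OF B b]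
    zero_exactly_one(2)[OF C c] b c d
  by (cases "f_zero B b"; cases "f_zero C c"; cases "f_zero D d") (auto simp: tensor_f_zero_def)


text \<open>
  Once the first two weights of \<open>b\<close> are not both zero, a twist couples \<open>b\<close> to the first factor to
  its right with nonzero first weight, because \<open>e\<^sub>0\<close> and \<open>f\<^sub>0\<close> pass over factors of first weight
  zero; if those two weights of \<open>b\<close> vanish, \<open>b\<close> is skipped altogether.  Both descriptions do not
  depend on the bracketing.  The raising operator is used because its twists occur at first weight
  zero, a condition that holds for a tensor product only if it holds for both factors.
\<close>
lemma tensor_bar_assoc:
  assumes B: "qplus_crystal n B" and C: "qplus_crystal n C"
    and b: "b \<in> carrier B" and c: "c \<in> carrier C" and d: "d \<in> carrier D"
  shows "e_bar (tensor_structure n B (tensor_structure n C D)) (b, (c, d)) =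
    map_option reassoc (e_bar (tensor_structure n (tensor_structure n B C) D) ((b, c), d))"
proof -
  let ?T = "tensor_structure n B C" and ?U = "tensor_structure n C D"
  have nonneg: "0 \<le> wt B b 1" "0 \<le> wt B b 2" "0 \<le> wt C c 1" "0 \<le> wt C c 2"
    using qplus_wt_nonneg[OF B b] qplus_wt_nonneg[OF C c] by blast+
  have "tensor_e_bar B ?U (b, (c, d)) = map_option reassoc (tensor_e_bar ?T D ((b, c), d))"
    if n: "2 \<le> n"
  proof -
    \<comment> \<open>In case 2 a twist passes over \<open>c\<close> to \<open>d\<close>, in case 3 it stops at \<open>c\<close>.\<close>
    consider (1) "wt B b 1 = 0" "wt B b 2 = 0" | (2) "wt B b 1 = 0" "wt B b 2 \<noteq> 0" "wt C c 1 = 0"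
      | (3) "wt B b 1 = 0" "wt B b 2 \<noteq> 0" "wt C c 1 \<noteq> 0" | (4) "wt B b 1 \<noteq> 0"
      by blast
    then show ?thesis
    proof cases
      case 1
      show ?thesis
      proof (cases "e_bar C c")
        case None
        then show ?thesis using 1 b c d n
          by (cases "e_bar D d") (simp_all add: tensor_e_bar_def)
      next
        case (Some c')
        have c': "c' \<in> carrier C" using bar_carrier[OF C] Some by blast
        show ?thesis
          using 1 b c d c' n Some
          by (cases "e_bar D d"; cases "f_zero C c'"; cases "e_zero C c'"; cases "e_zero D d"; cases "f_zero D d")
            (simp_all add: tensor_e_bar_def tensor_f_zero_def tensor_e_zero_def)
      qed
    next
      case 2
      note c0 = zero_exactly_one(1,2)[OF C c 2(3)]
      have w2: "wt B b 2 + wt C c 2 \<noteq> 0" using nonneg 2 by simp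
      show ?thesis
      proof (cases "e_bar B b")
        case None
        then show ?thesis using 2 w2 b c d n by (simp add: tensor_e_bar_def)
      next
        case (Some x)
        have x: "x \<in> carrier B" "wt B x 1 = 1"
          using bar_carrier[OF B, of b x] bar_wt12(1)[OF B Some] Some 2 by auto
        show ?thesis
          using 2 w2 b c d x n Some c0
          by (cases "f_zero B x"; cases "e_zero B x"; cases "e_zero D d"; cases "f_zero D d")
            (simp_all add: tensor_e_bar_def tensor_f_zero_def tensor_e_zero_def)
      qed
    next
      case 3
      have "wt B b 1 + wt C c 1 \<noteq> 0" using nonneg 3 by simp
      then show ?thesis using 3 b c d n
        by (cases "e_bar B b"; cases "f_zero B (the (e_bar B b))"; cases "e_zero B (the (e_bar B b))";
            cases "e_zero C c"; cases "f_zero C c")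
          (simp_all add: tensor_e_bar_def tensor_f_zero_def tensor_e_zero_def)
    next
      case 4
      have "wt B b 1 + wt C c 1 \<noteq> 0" using nonneg 4 by simp
      then show ?thesis using 4 b c d n
        by (cases "e_bar B b") (simp_all add: tensor_e_bar_def)
    qed
  qed
  then show ?thesis using b c d by simp
qed

theorem reassoc_qplus_iso:
  assumes B: "qplus_crystal n B" and C: "qplus_crystal n C" and D: "qplus_crystal n D"
  shows "qplus_iso n (tensor_structure n (tensor_structure n B C) D)
    (tensor_structure n B (tensor_structure n C D)) reassoc"
proof -
  let ?L = "tensor_structure n (tensor_structure n B C) D"
  let ?R = "tensor_structure n B (tensor_structure n C D)"
  note BC = qplus_crystal_tensor_structure[OF B C] and CD = qplus_crystal_tensor_structure[OF C D]
  have inj: "reassoc x = reassoc y \<longleftrightarrow> x = y" for x y :: "('a \<times> 'b) \<times> 'c"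
    by (auto split: prod.splits)
  have transfer: "g x = Some y \<longleftrightarrow> h (reassoc x) = Some (reassoc y)"
    if "h (reassoc x) = map_option reassoc (g x)"
    for x y :: "('a \<times> 'b) \<times> 'c" and g h
    using that inj by (cases "g x") auto
  have car: "reassoc x \<in> carrier ?R \<longleftrightarrow> x \<in> carrier ?L" for x
    by (cases x) auto
  have bij: "bij_betw reassoc (carrier ?L) (carrier ?R)"
    by (rule bij_betw_byWitness[where f' = "\<lambda>(b, (c, d)). ((b, c), d)"]) auto
  have wt: "wt ?R (reassoc x) = wt ?L x" for x
    by (cases x) (auto simp: gl_tensor_def)
  have lower: "lower ?L l x = Some y \<longleftrightarrow> lower ?R l (reassoc x) = Some (reassoc y)"
    if x: "x \<in> carrier ?L" and y: "y \<in> carrier ?L" for l x y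
  proof (cases l)
    case Label_zero
    have "f_zero ?R (reassoc x) = map_option reassoc (f_zero ?L x)"
      using x tensor_zero_assoc[OF B C, of "fst (fst x)" "snd (fst x)" "snd x" D] by (cases x) auto
    then show ?thesis unfolding Label_zero lower.simps by (rule transfer)
  next
    case Label_bar
    \<comment> \<open>A lowering edge from \<open>x\<close> to \<open>y\<close> is read backwards, as a raising edge from \<open>y\<close> to \<open>x\<close>.\<close>
    have "e_bar ?R (reassoc y) = map_option reassoc (e_bar ?L y)"
      using y tensor_bar_assoc[OF B C, of "fst (fst y)" "snd (fst y)" "snd y" D] by (cases y) auto
    then show ?thesis unfolding Label_bar lower.simps
        tensor_structure_inverse(2)[OF BC D, symmetric] tensor_structure_inverse(2)[OF B CD, symmetric]
      by (rule transfer)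
  next
    case (Label i)
    have "f_op ?R i (reassoc x) = map_option reassoc (f_op ?L i x)"
      using x gl_tensor_assoc[OF qplus_gl[OF B] qplus_gl[OF C] qplus_gl[OF D],
          of "fst (fst x)" "snd (fst x)" "snd x"] by (cases x) auto
    then show ?thesis unfolding Label lower.simps by (rule transfer)
  qed
  show ?thesis
    unfolding qplus_iso_def crystal_edge_def using bij wt lower car by blast
qed

theorem theorem3p14:
  fixes n :: nat
    and B :: "'b qplus_data" and C :: "'c qplus_data" and D :: "'d qplus_data"
  assumes "1 \<le> n"
    and "qplus_crystal n B" and "qplus_crystal n C"
  shows "(\<exists>!X. is_qplus_tensor n B C X) \<and>
    (qplus_crystal n D \<longrightarrow>
      qplus_iso n (qplus_tensor n (qplus_tensor n B C) D) (qplus_tensor n B (qplus_tensor n C D))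
        (\<lambda>((b, c), d). (b, (c, d))))"
proof (intro conjI impI)
  note BC = assms(2,3)
  show "\<exists>!X. is_qplus_tensor n B C X"
    using is_qplus_tensor_tensor_structure[OF BC] is_qplus_tensor_unique by blast
  assume D: "qplus_crystal n D"
  show "qplus_iso n (qplus_tensor n (qplus_tensor n B C) D) (qplus_tensor n B (qplus_tensor n C D))
        (\<lambda>((b, c), d). (b, (c, d)))"
    using reassoc_qplus_iso[OF BC D] qplus_crystal_tensor_structure[OF BC]
      qplus_crystal_tensor_structure[OF BC(2) D] BC D
    by (simp add: qplus_tensor_eq)
qed

end
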